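(* Consider the equation with $g$ constant ($g^-=g^+=:g^\pm$) and $v$ monotonically decreasing ($v^->v^+$), so that the delay at a steady state $\xi$ is $\tau(\xi)=a/v(\xi)$. Let $\xi$ be the (unique) steady state. Then: (1) If $\big|\xi v'(\xi)/v(\xi)\big|<\frac{1}{\mu\tau(\xi)}$, then $\xi$ is asymptotically stable. (2) $\xi$ is asymptotically stable if $m\le1/(\mu\tau(\xi))$, or if both $m>1/(\mu\tau(\xi))$ and $r_v=v^-/v^+<\big(1+\frac{2}{m\mu\tau(\xi)-1}\big)^2$. (3) For any fixed $m>0$, the steady state is asymptotically stable whenever $\xi>0$ is sufficiently small or sufficiently large, equivalently whenever $\gamma$ is sufficiently large or $\gamma>0$ is sufficiently small. (4) If $\gamma>\mu$, the steady state is asymptotically stable. (5) For any fixed $\xi\ne\theta_v$ let $\gamma=\gamma(m,\xi)$ be the value of $\gamma$ for which $\xi$ is a steady state; or, for any fixed $\gamma$ with $0<\gamma<\gamma_3$ or $\gamma>\gamma_4$, let $\xi=\xi(m,\gamma)$ be the steady state. Then $\xi$ is asymptotically stable for all $m$ sufficiently large. (6) Let $\mu>\gamma_3$. (a) For any $k>0$, for all $m=m(k)$ sufficiently large there are two families of (at least) $k+1$ Hopf bifurcations as $\gamma$ is varied; in the first family the characteristic values $\lambda_j=\alpha_j\pm i\omega_j$ with $\omega_j\tau\in((2j+1)\pi,(2j+2)\pi)$, $j=0,1,\dots,k$, cross the imaginary axis from left to right as $\gamma$ increases, while in the second family they cross from right to left. (b) Let $\gamma\in(\gamma_3,\min\{\gamma_4,\mu\})$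 be fixed. Then as $m$ is increased there is an infinite sequence of Hopf bifurcations where the real part of $\lambda_k=\alpha_k\pm i\omega_k$ becomes positive, with $\omega_k\tau\in((2k+1)\pi,(2k+2)\pi)$.
   Context: The model is the scalar delay differential equation $x'(t)=\beta e^{-\mu\tau(t)}\frac{v(x(t))}{v(x(t-\tau(t)))}g(x(t-\tau(t)))-\gamma x(t)$ with the delay defined by $a=\int_{t-\tau(t)}^t v(x(s))\,ds$, constants $\beta,\mu,\gamma,a>0$, and Hill functions $g(x)=\frac{g^-\theta_g^n+g^+x^n}{\theta_g^n+x^n}$, $v(x)=\frac{v^-\theta_v^m+v^+x^m}{\theta_v^m+x^m}$ with all parameters positive; here $g\equiv g^\pm$ is constant. A steady state is a constant solution $x\equiv\xi>0$; it satisfies $\tau(\xi)=a/v(\xi)$ and $\beta g^\pm e^{-\mu\tau(\xi)}=\gamma\xi$; for decreasing $v$ it is unique, and for each $\xi>0$ the unique $\gamma$ making $\xi$ a steady state is $\gamma(\xi)=\beta g^\pm e^{-\mu\tau(\xi)}/\xi$. Characteristic values are the roots $\lambda\in\mathbb{C}$ of $\lambda+\gamma-A+Ae^{-\lambda\tau(\xi)}-\mu A\int_{-\tau(\xi)}^0e^{\lambda s}ds=0$ with $A=\beta\frac{v'(\xi)}{v(\xi)}e^{-\mu\tau(\xi)}g^\pm$; the steady state is asymptotically stable if all have negative real part and unstable if one has positive real part. A Hopf bifurcation is a parameter value at which a pair of characteristic values $\pm i\omega$, $\omega>0$, lies on (crosses) the imaginary axis. Notation: $\tau^\pm=a/v^\pm$,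 $\gamma_3=\beta g^\pm e^{-\mu\tau^+}/\theta_v$, $\gamma_4=\beta g^\pm e^{-\mu\tau^-}/\theta_v$ (so $\gamma_3<\gamma_4$ here); in (6), $\tau$ denotes $\tau(\xi)$ at the bifurcating steady state. *)

theory Defs
  imports "HOL-Analysis.Analysis"
begin

text \<open>Fixed model parameters (g is constant, equal to g^+ = g^-; thetav is theta_v).
  The Hill exponent m and the decay rate gamma are kept as separate arguments,
  since they are varied in the theorem.\<close>
record dde_params =
  beta :: real
  mu :: real
  adel :: real
  gpm :: real
  vminus :: real
  vplus :: real
  thetav :: real

definition hill :: "real \<Rightarrow> real \<Rightarrow> real \<Rightarrow> real \<Rightarrow> real \<Rightarrow> real" where
  "hill lo hi th n x = (lo * th powr n + hi * x powr n) / (th powr n + x powr n)"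

definition vfun :: "dde_params \<Rightarrow> real \<Rightarrow> real \<Rightarrow> real" where
  "vfun P m x = hill (vminus P) (vplus P) (thetav P) m x"

definition tau :: "dde_params \<Rightarrow> real \<Rightarrow> real \<Rightarrow> real" where
  "tau P m x = adel P / vfun P m x"

definition coefA :: "dde_params \<Rightarrow> real \<Rightarrow> real \<Rightarrow> real" where
  "coefA P m x = beta P * deriv (vfun P m) x / vfun P m x * exp (- mu P * tau P m x) * gpm P"

definition charfun :: "dde_params \<Rightarrow> real \<Rightarrow> real \<Rightarrow> real \<Rightarrow> complex \<Rightarrow> complex" where
  "charfun P m gam x z =
     (let t = tau P m x; A = complex_of_real (coefA P m x) in
      z + complex_of_real gam - A + A * exp (- z * complex_of_real t)
        - complex_of_real (mu P) * A * integral {-t..0} (\<lambda>s. exp (z * complex_of_real s)))"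

definition is_steady :: "dde_params \<Rightarrow> real \<Rightarrow> real \<Rightarrow> real \<Rightarrow> bool" where
  "is_steady P m gam x \<longleftrightarrow> x > 0 \<and> beta P * gpm P * exp (- mu P * tau P m x) = gam * x"

definition steady :: "dde_params \<Rightarrow> real \<Rightarrow> real \<Rightarrow> real" where
  "steady P m gam = (THE x. is_steady P m gam x)"

definition gamma_of :: "dde_params \<Rightarrow> real \<Rightarrow> real \<Rightarrow> real" where
  "gamma_of P m x = beta P * gpm P * exp (- mu P * tau P m x) / x"

definition gamma3 :: "dde_params \<Rightarrow> real" where
  "gamma3 P = beta P * gpm P * exp (- mu P * (adel P / vplus P)) / thetav P"

definition gamma4 :: "dde_params \<Rightarrow> real" where
  "gamma4 P = beta P * gpm P * exp (- mu P * (adel P / vminus P)) / thetav P"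

definition asym_stable :: "dde_params \<Rightarrow> real \<Rightarrow> real \<Rightarrow> real \<Rightarrow> bool" where
  "asym_stable P m gam x \<longleftrightarrow> (\<forall>z. charfun P m gam x z = 0 \<longrightarrow> Re z < 0)"

text \<open>Hopf bifurcation at parameter value p0 for a parameter-dependent characteristic
  function C: a continuous branch L of characteristic values with L p0 = i omega, omega > 0,
  crossing the imaginary axis from left to right (resp. right to left) as p increases.\<close>
definition crosses_lr :: "(real \<Rightarrow> complex \<Rightarrow> complex) \<Rightarrow> real \<Rightarrow> real \<Rightarrow> bool" where
  "crosses_lr C p0 \<omega> \<longleftrightarrow> \<omega> > 0 \<and> (\<exists>\<epsilon>>0. \<exists>L. L p0 = \<i> * complex_of_real \<omega> \<and>
      continuous_on {p0 - \<epsilon>..p0 + \<epsilon>} L \<and>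
      (\<forall>p\<in>{p0 - \<epsilon>..p0 + \<epsilon>}. C p (L p) = 0) \<and>
      (\<forall>p\<in>{p0 - \<epsilon><..<p0}. Re (L p) < 0) \<and>
      (\<forall>p\<in>{p0<..<p0 + \<epsilon>}. Re (L p) > 0))"

definition crosses_rl :: "(real \<Rightarrow> complex \<Rightarrow> complex) \<Rightarrow> real \<Rightarrow> real \<Rightarrow> bool" where
  "crosses_rl C p0 \<omega> \<longleftrightarrow> \<omega> > 0 \<and> (\<exists>\<epsilon>>0. \<exists>L. L p0 = \<i> * complex_of_real \<omega> \<and>
      continuous_on {p0 - \<epsilon>..p0 + \<epsilon>} L \<and>
      (\<forall>p\<in>{p0 - \<epsilon>..p0 + \<epsilon>}. C p (L p) = 0) \<and>
      (\<forall>p\<in>{p0 - \<epsilon><..<p0}. Re (L p) > 0) \<and>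
      (\<forall>p\<in>{p0<..<p0 + \<epsilon>}. Re (L p) < 0))"

end

theory Submission
  imports Defs "HOL-Complex_Analysis.Complex_Analysis" "HOL-Real_Asymp.Real_Asymp"
begin

text \<open>
  At a steady state put \<open>B = -A > 0\<close>; then \<open>\<lambda>\<close> times the characteristic function is
  \<open>\<lambda>(\<lambda> + \<gamma>) + B(\<lambda> + \<mu>)(1 - e\<^bsup>-\<lambda>\<tau>\<^esup>)\<close>. Stability follows by taking real parts, together with bounds
  for \<open>B/\<gamma> = m h(y)\<close>, where \<open>y = (\<xi>/\<theta>\<^sub>v)\<^sup>m\<close> and \<open>h\<close> is a rational function.

  On the imaginary axis the modulus condition
  \<open>|\<lambda>(\<lambda> + \<gamma>) + B(\<lambda> + \<mu>)| = |B(\<lambda> + \<mu>)|\<close> forces \<open>\<omega>\<^sup>2 = 2B(\<mu> - \<gamma>) - \<gamma>\<^sup>2\<close>, and \<open>i\<omega>\<close> is then a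
  characteristic value iff the phase \<open>\<omega>\<tau> + 2 arctan(\<omega>/(2B + \<gamma>))\<close> is a multiple of \<open>2\<pi>\<close>.
  The phase is an explicit real-analytic function along any of the parameter curves, so a level
  that it passes is crossed at an isolated point with a strict sign change. The derivative of
  \<open>\<lambda>\<tau> + Ln((\<lambda>(\<lambda> + \<gamma>) + B(\<lambda> + \<mu>))/(B(\<lambda> + \<mu>)))\<close> has imaginary part
  \<open>- \<omega>\<^sup>3/(B\<^sup>2(\<omega>\<^sup>2 + \<mu>\<^sup>2)) < 0\<close> at \<open>i\<omega>\<close>, so the real part of the nearby root has the sign
  of the phase deviation. Finally \<open>\<omega>\<close> is small or undefined where \<open>B\<close> is small or
  \<open>\<gamma> \<ge> \<mu>\<close>, and large for large \<open>m\<close> in the transition layer of \<open>v\<close>.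
\<close>

section \<open>Real-analytic functions\<close>

definition real_analytic_on :: "(real \<Rightarrow> real) \<Rightarrow> real set \<Rightarrow> bool" (infixl "real'_analytic'_on" 50)
  where "f real_analytic_on S \<longleftrightarrow>
    (\<exists>g. g analytic_on (complex_of_real ` S) \<and> (\<forall>x\<in>S. g (of_real x) = of_real (f x)))"

named_theorems real_analytic_intros

lemma real_analytic_on_const [real_analytic_intros]: "(\<lambda>x. c) real_analytic_on S"
  unfolding real_analytic_on_def by (intro exI[of _ "\<lambda>z. of_real c"]) auto

lemma real_analytic_on_ident [real_analytic_intros]: "(\<lambda>x. x) real_analytic_on S"
  unfolding real_analytic_on_def by (intro exI[of _ "\<lambda>z. z"]) auto

lemma real_analytic_on_subset: "f real_analytic_on S \<Longrightarrow> T \<subseteq> S \<Longrightarrow> f real_analytic_on T"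
  unfolding real_analytic_on_def by (meson analytic_on_subset image_mono subsetD)

lemma real_analytic_on_add [real_analytic_intros]:
  assumes "f real_analytic_on S" "g real_analytic_on S"
  shows "(\<lambda>x. f x + g x) real_analytic_on S"
proof -
  obtain F G where "F analytic_on (of_real ` S)" "G analytic_on (of_real ` S)"
    "\<forall>x\<in>S. F (of_real x) = of_real (f x)" "\<forall>x\<in>S. G (of_real x) = of_real (g x)"
    using assms unfolding real_analytic_on_def by blast
  then show ?thesis
    unfolding real_analytic_on_def
    by (intro exI[of _ "\<lambda>z. F z + G z"]) (auto intro!: analytic_intros)
qed

lemma real_analytic_on_mult [real_analytic_intros]:
  assumes "f real_analytic_on S" "g real_analytic_on S"
  shows "(\<lambda>x. f x * g x) real_analytic_on S"
proof -
  obtain F G where "F analytic_on (of_real ` S)" "G analytic_on (of_real ` S)"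
    "\<forall>x\<in>S. F (of_real x) = of_real (f x)" "\<forall>x\<in>S. G (of_real x) = of_real (g x)"
    using assms unfolding real_analytic_on_def by blast
  then show ?thesis
    unfolding real_analytic_on_def
    by (intro exI[of _ "\<lambda>z. F z * G z"]) (auto intro!: analytic_intros)
qed

lemma real_analytic_on_compose:
  assumes "f real_analytic_on S" "H analytic_on (of_real ` f ` S)"
    "\<And>x. x \<in> S \<Longrightarrow> H (of_real (f x)) = of_real (h (f x))"
  shows "(\<lambda>x. h (f x)) real_analytic_on S"
proof -
  obtain F where F: "F analytic_on (of_real ` S)" "\<And>x. x \<in> S \<Longrightarrow> F (of_real x) = of_real (f x)"
    using assms(1) unfolding real_analytic_on_def by blast
  have "F ` of_real ` S = of_real ` f ` S"
    using F(2) by (force simp: image_iff)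
  then have "(H \<circ> F) analytic_on (of_real ` S)"
    using analytic_on_compose[OF F(1)] assms(2) by auto
  then show ?thesis
    unfolding real_analytic_on_def using F(2) assms(3) by (intro exI[of _ "H \<circ> F"]) auto
qed

lemma real_analytic_on_uminus [real_analytic_intros]:
  assumes "f real_analytic_on S"
  shows "(\<lambda>x. - f x) real_analytic_on S"
  by (rule real_analytic_on_compose[OF assms, of uminus]) (auto intro!: analytic_intros)

lemma real_analytic_on_diff [real_analytic_intros]:
  assumes "f real_analytic_on S" "g real_analytic_on S"
  shows "(\<lambda>x. f x - g x) real_analytic_on S"
  using real_analytic_on_add[OF assms(1) real_analytic_on_uminus[OF assms(2)]] by simp

lemma real_analytic_on_inverse:
  assumes "f real_analytic_on S" "\<And>x. x \<in> S \<Longrightarrow> f x \<noteq> 0"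
  shows "(\<lambda>x. inverse (f x)) real_analytic_on S"
  by (rule real_analytic_on_compose[OF assms(1), of inverse])
     (use assms(2) in \<open>auto intro!: analytic_intros\<close>)

lemma real_analytic_on_divide [real_analytic_intros]:
  assumes "f real_analytic_on S" "g real_analytic_on S" "\<And>x. x \<in> S \<Longrightarrow> g x \<noteq> 0"
  shows "(\<lambda>x. f x / g x) real_analytic_on S"
  using real_analytic_on_mult[OF assms(1) real_analytic_on_inverse[OF assms(2,3)]]
  by (simp add: divide_inverse)

lemma real_analytic_on_exp [real_analytic_intros]:
  assumes "f real_analytic_on S"
  shows "(\<lambda>x. exp (f x)) real_analytic_on S"
  by (rule real_analytic_on_compose[OF assms, of exp]) (auto intro!: analytic_intros simp: exp_of_real)

lemma real_analytic_on_ln [real_analytic_intros]: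
  assumes "f real_analytic_on S" "\<And>x. x \<in> S \<Longrightarrow> f x > 0"
  shows "(\<lambda>x. ln (f x)) real_analytic_on S"
proof (rule real_analytic_on_compose[OF assms(1), of Ln])
  show "Ln analytic_on (of_real ` f ` S)"
    using assms(2) by (intro analytic_on_ln analytic_on_ident) (fastforce dest: assms(2))
qed (simp add: Ln_of_real assms(2))

lemma real_analytic_on_sqrt [real_analytic_intros]:
  assumes "f real_analytic_on S" "\<And>x. x \<in> S \<Longrightarrow> f x > 0"
  shows "(\<lambda>x. sqrt (f x)) real_analytic_on S"
proof (rule real_analytic_on_compose[OF assms(1), of csqrt])
  show "csqrt analytic_on (of_real ` f ` S)"
    by (rule analytic_on_subset[OF analytic_on_csqrt]) (fastforce dest: assms(2))
  show "csqrt (of_real (f x)) = of_real (sqrt (f x))" if "x \<in> S" for x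
    using assms(2)[OF that] by (intro of_real_sqrt[symmetric]) simp
qed

lemma real_analytic_on_arctan [real_analytic_intros]:
  assumes "f real_analytic_on S"
  shows "(\<lambda>x. arctan (f x)) real_analytic_on S"
proof (rule real_analytic_on_compose[OF assms, of Arctan])
  have "open {z::complex. \<bar>Im z\<bar> < 1}"
    by (intro open_Collect_less continuous_intros)
  moreover have "Arctan holomorphic_on {z. \<bar>Im z\<bar> < 1}"
    by (rule holomorphic_on_Arctan) auto
  ultimately have "Arctan analytic_on {z. \<bar>Im z\<bar> < 1}"
    by (simp add: analytic_on_open)
  then show "Arctan analytic_on (of_real ` f ` S)"
    by (rule analytic_on_subset) auto
qed (simp add: Arctan_of_real)

lemma real_analytic_on_imp_continuous_on:
  assumes "f real_analytic_on S"
  shows "continuous_on S f"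
proof -
  obtain F where F: "F analytic_on (of_real ` S)" "\<And>x. x \<in> S \<Longrightarrow> F (of_real x) = of_real (f x)"
    using assms unfolding real_analytic_on_def by blast
  have "continuous_on (of_real ` S) F"
    using F(1) analytic_imp_holomorphic holomorphic_on_imp_continuous_on by blast
  then have "continuous_on S (\<lambda>x. Re (F (of_real x)))"
    by (intro continuous_intros continuous_on_compose2[of "of_real ` S" F S of_real]) auto
  then show ?thesis
    by (rule continuous_on_eq) (simp add: F(2))
qed

lemma real_analytic_sign_change:
  assumes "a < b" and f: "f real_analytic_on {a..b}" and fa: "f a < 0" and fb: "f b > 0"
  obtains p e where "e > 0" "a \<le> p - e" "p + e \<le> b" "f p = 0"
    "\<And>x. x \<in> {p - e..<p} \<Longrightarrow> f x < 0" "\<And>x. x \<in> {p<..p + e} \<Longrightarrow> f x > 0"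
proof -
  have cont: "continuous_on {a..b} f"
    using f by (rule real_analytic_on_imp_continuous_on)
  obtain F where F: "F analytic_on (of_real ` {a..b})"
      "\<And>x. x \<in> {a..b} \<Longrightarrow> F (of_real x) = of_real (f x)"
    using f unfolding real_analytic_on_def by blast
  then obtain T where T: "open T" "of_real ` {a..b} \<subseteq> T" "F holomorphic_on T"
    unfolding analytic_on_holomorphic by blast
  define S where "S = connected_component_set T (of_real a)"
  have S: "open S" "connected S" "S \<subseteq> T"
    unfolding S_def using T(1) by (auto simp: open_connected_component connected_component_subset)
  have sub: "of_real ` {a..b} \<subseteq> S"
    unfolding S_def using T(2) \<open>a < b\<close>
    by (intro connected_component_maximal connected_continuous_image continuous_intros) auto
  define X where "X = {x \<in> {a..b}. f x > 0}"
  define p where "p = Inf X"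
  have bX: "b \<in> X" and bdd: "bdd_below X"
    unfolding X_def using fb \<open>a < b\<close> by (auto intro: bdd_belowI[of _ a])
  have pab: "a \<le> p" "p \<le> b"
    unfolding p_def using bX bdd by (auto intro!: cInf_greatest cInf_lower simp: X_def)
  have left: "f x \<le> 0" if "x \<in> {a..<p}" for x
  proof (rule ccontr)
    assume "\<not> f x \<le> 0"
    then have "x \<in> X"
      using that pab unfolding X_def by auto
    then have "p \<le> x"
      unfolding p_def using bdd by (rule cInf_lower)
    then show False
      using that by simp
  qed
  have nbhd: "\<exists>d>0. \<forall>y\<in>{a..b}. \<bar>y - p\<bar> < d \<longrightarrow> \<bar>f y - f p\<bar> < e" if "e > 0" for e
    using cont[unfolded continuous_on_iff dist_real_def, rule_format, of p e] pab that by simp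
  have near: "\<exists>x\<in>X. x < p + d" if "d > 0" for d
    using cInf_lessD[of X "p + d"] bX that unfolding p_def by auto
  have fp: "f p = 0"
  proof (rule antisym; rule ccontr)
    assume *: "\<not> f p \<le> 0"
    then have "a < p"
      using fa pab(1) by (metis linorder_not_le order_le_less order_less_asym)
    obtain d where d: "d > 0" "\<forall>y\<in>{a..b}. \<bar>y - p\<bar> < d \<longrightarrow> \<bar>f y - f p\<bar> < f p"
      using nbhd[of "f p"] * by auto
    define y where "y = max a (p - d / 2)"
    have "y \<in> {a..<p}" "\<bar>y - p\<bar> < d"
      unfolding y_def using \<open>a < p\<close> d(1) by auto
    then have "f y \<le> 0" "\<bar>f y - f p\<bar> < f p"
      using left d(2) pab by auto
    then show False
      by linarith
  next
    assume *: "\<not> 0 \<le> f p"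
    obtain d where d: "d > 0" "\<forall>y\<in>{a..b}. \<bar>y - p\<bar> < d \<longrightarrow> \<bar>f y - f p\<bar> < - f p"
      using nbhd[of "- f p"] * by auto
    obtain x where x: "x \<in> X" "x < p + d"
      using near[OF d(1)] by blast
    have "p \<le> x"
      unfolding p_def using x(1) bdd by (rule cInf_lower)
    then have "\<bar>f x - f p\<bar> < - f p" "f x > 0"
      using d(2) x unfolding X_def by auto
    then show False
      by linarith
  qed
  have p: "a < p" "p < b"
    using pab fp fa fb by (metis order_less_irrefl order_le_less)+
  obtain r where r: "r > 0" "\<And>z. z \<in> ball (of_real p) r - {of_real p} \<Longrightarrow> F z \<noteq> 0"
  proof (rule isolated_zeros[of F S "of_real p" "of_real a"])
    show "F holomorphic_on S"
      using T(3) S(3) by (rule holomorphic_on_subset)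
  qed (use S sub p F(2) fp fa in auto)
  have nz: "f x \<noteq> 0" if "x \<in> {a..b}" "\<bar>x - p\<bar> < r" "x \<noteq> p" for x
  proof -
    have "of_real x \<in> ball (complex_of_real p) r - {of_real p}"
      using that by (auto simp: dist_commute dist_real_def simp flip: of_real_diff)
    then show ?thesis
      using r(2) F(2) that(1) by (metis of_real_0)
  qed
  define e where "e = min (r / 2) (min (p - a) (b - p))"
  have e: "e > 0" "a \<le> p - e" "p + e \<le> b" "e < r"
    unfolding e_def using r(1) p by auto
  show ?thesis
  proof (rule that[OF e(1-3) fp])
    fix x
    assume x: "x \<in> {p - e..<p}"
    have "f x \<le> 0"
      using x e(2) by (intro left) simp
    moreover have "f x \<noteq> 0"
      using x e p by (intro nz) (simp_all add: abs_if)
    ultimately show "f x < 0"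
      by linarith
  next
    fix x
    assume x: "x \<in> {p<..p + e}"
    obtain y where y: "y \<in> X" "y < p + e"
      using near[OF e(1)] by blast
    have "p \<le> y"
      unfolding p_def using y(1) bdd by (rule cInf_lower)
    then have y': "p < y" "f y > 0"
      using y(1) fp unfolding X_def by (force simp: order_less_le)+
    show "f x > 0"
    proof (rule ccontr)
      assume "\<not> f x > 0"
      then have "0 \<in> {f x..f y}"
        using y'(2) by simp
      moreover have "continuous_on (closed_segment x y) f"
        using x y y' e p
        by (intro continuous_on_subset[OF cont]) (simp add: closed_segment_eq_real_ivl)
      then have "connected (f ` closed_segment x y)"
        by (rule connected_continuous_image) simp
      then have "{f x..f y} \<subseteq> f ` closed_segment x y"
        by (rule connected_contains_Icc) auto
      ultimately have "0 \<in> f ` closed_segment x y"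
        by blast
      then obtain w where w: "w \<in> closed_segment x y" "f w = 0"
        by auto
      have "p < w" "w \<le> p + e"
        using w(1) x y y' unfolding closed_segment_eq_real_ivl by (auto split: if_splits)
      then have "w \<in> {a..b}" "\<bar>w - p\<bar> < r" "w \<noteq> p"
        using e p by (simp_all add: abs_if)
      then show False
        using nz w(2) by blast
    qed
  qed
qed

section \<open>Continuous branches of roots\<close>

lemma continuous_root_branch:
  fixes g g' :: "real \<Rightarrow> complex \<Rightarrow> complex"
  assumes r: "r > 0" and c: "c \<noteq> 0"
    and der: "\<And>t z. t \<in> I \<Longrightarrow> z \<in> cball z0 r \<Longrightarrow> (g t has_field_derivative g' t z) (at z)"
    and close: "\<And>t z. t \<in> I \<Longrightarrow> z \<in> cball z0 r \<Longrightarrow> norm (g' t z - c) \<le> norm c / 2"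
    and cont: "\<And>z. z \<in> cball z0 r \<Longrightarrow> continuous_on I (\<lambda>t. g t z)"
    and small: "\<And>t. t \<in> I \<Longrightarrow> norm (g t z0) \<le> norm c * r / 2"
  obtains L where "continuous_on I L" "\<And>t. t \<in> I \<Longrightarrow> L t \<in> cball z0 r" "\<And>t. t \<in> I \<Longrightarrow> g t (L t) = 0"
proof -
  define N where "N t z = z - g t z / c" for t z
  have lip: "norm (N t z - N t w) \<le> 1/2 * norm (z - w)"
    if "t \<in> I" "z \<in> cball z0 r" "w \<in> cball z0 r" for t z w
  proof (rule field_differentiable_bound[of "cball z0 r"])
    fix x
    assume x: "x \<in> cball z0 r"
    show "(N t has_field_derivative (1 - g' t x / c)) (at x within cball z0 r)"
      unfolding N_def using der[OF that(1) x, THEN DERIV_subset, of "cball z0 r"]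
      by (auto intro!: derivative_eq_intros simp: c)
    have "1 - g' t x / c = - (g' t x - c) / c"
      using c by (simp add: field_simps)
    then show "norm (1 - g' t x / c) \<le> 1/2"
      using close[OF that(1) x] c by (simp add: norm_divide norm_minus_commute field_simps)
  qed (use that in auto)
  have self: "N t ` cball z0 r \<subseteq> cball z0 r" if "t \<in> I" for t
  proof safe
    fix z
    assume z: "z \<in> cball z0 r"
    have "norm (N t z - N t z0) \<le> 1/2 * norm (z - z0)"
      using lip[OF that z] r by simp
    moreover have "norm (z - z0) \<le> r"
      using z by (simp add: dist_norm norm_minus_commute)
    moreover have "norm (N t z0 - z0) \<le> r / 2"
      unfolding N_def using small[OF that] c by (simp add: norm_divide field_simps)
    ultimately have "norm (N t z - z0) \<le> r"
      using norm_triangle_ineq[of "N t z - N t z0" "N t z0 - z0"] by simp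
    then show "N t z \<in> cball z0 r"
      by (simp add: dist_norm norm_minus_commute)
  qed
  have "\<exists>z. t \<in> I \<longrightarrow> z \<in> cball z0 r \<and> N t z = z" for t
  proof (cases "t \<in> I")
    case True
    have "\<exists>!z\<in>cball z0 r. N t z = z"
      by (rule Banach_fix[of _ "1/2"])
        (use self[OF True] lip[OF True] r in \<open>auto simp: dist_norm complete_eq_closed\<close>)
    then show ?thesis
      by blast
  qed auto
  then obtain L where L: "\<And>t. t \<in> I \<Longrightarrow> L t \<in> cball z0 r" "\<And>t. t \<in> I \<Longrightarrow> N t (L t) = L t"
    by metis
  show ?thesis
  proof
    show "g t (L t) = 0" if "t \<in> I" for t
      using L(2)[OF that] c unfolding N_def by simp
    show "continuous_on I L"
      unfolding continuous_on_def
    proof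
      fix s
      assume s: "s \<in> I"
      have bound: "norm (L t - L s) \<le> 2 * norm (g t (L s) - g s (L s)) / norm c" if "t \<in> I" for t
      proof -
        have "L t - L s = (N t (L t) - N t (L s)) + (N t (L s) - N s (L s))"
          using L(2) that s by simp
        also have "norm \<dots> \<le> 1/2 * norm (L t - L s) + norm (N t (L s) - N s (L s))"
          by (intro norm_triangle_mono lip L(1) that s) simp
        also have "N t (L s) - N s (L s) = - (g t (L s) - g s (L s)) / c"
          unfolding N_def using c by (simp add: field_simps)
        finally show ?thesis
          by (simp add: norm_divide norm_minus_commute)
      qed
      have "((\<lambda>t. g t (L s)) \<longlongrightarrow> g s (L s)) (at s within I)"
        using cont[OF L(1)[OF s]] s unfolding continuous_on_def by blast
      then have "((\<lambda>t. 2 * norm (g t (L s) - g s (L s)) / norm c) \<longlongrightarrow> 2 * norm (g s (L s) - g s (L s)) / norm c) (at s within I)"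
        by (intro tendsto_intros) (use c in auto)
      then have lim: "((\<lambda>t. 2 * norm (g t (L s) - g s (L s)) / norm c) \<longlongrightarrow> 0) (at s within I)"
        by simp
      have "((\<lambda>t. L t - L s) \<longlongrightarrow> 0) (at s within I)"
        by (rule Lim_null_comparison[OF _ lim])
          (use bound in \<open>auto simp: eventually_at_filter\<close>)
      then show "(L \<longlongrightarrow> L s) (at s within I)"
        using LIM_zero_cancel by blast
    qed
  qed (use L in auto)
qed

lemma Im_derivative_mean_value:
  assumes der: "\<And>z. z \<in> closed_segment w0 w \<Longrightarrow> (f has_field_derivative f' z) (at z)"
  obtains z where "z \<in> closed_segment w0 w"
    "Im ((f w - f w0) * cnj (w - w0)) = (norm (w - w0))\<^sup>2 * Im (f' z)"
proof -
  define d where "d = w - w0"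
  define h where "h s = Im (f (w0 + of_real s * d) * cnj d)" for s
  have seg: "w0 + of_real s * d \<in> closed_segment w0 w" if "0 \<le> s" "s \<le> 1" for s
    unfolding closed_segment_def d_def using that
    by (auto intro!: exI[of _ s] simp: scaleR_conv_of_real algebra_simps)
  have h': "(h has_real_derivative Im (f' (w0 + of_real s * d) * d * cnj d)) (at s)"
    if "0 \<le> s" "s \<le> 1" for s
  proof -
    have "((\<lambda>s. w0 + of_real s * d) has_vector_derivative d) (at s)"
      by (auto intro!: derivative_eq_intros simp: has_vector_derivative_def scaleR_conv_of_real)
    then have "((f \<circ> (\<lambda>s. w0 + of_real s * d)) has_vector_derivative d * f' (w0 + of_real s * d)) (at s)"
      using der[OF seg[OF that]] by (rule field_vector_diff_chain_at)
    then have "((\<lambda>s. f (w0 + of_real s * d)) has_vector_derivative d * f' (w0 + of_real s * d)) (at s)"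
      by (simp add: o_def)
    then have "((\<lambda>s. f (w0 + of_real s * d) * cnj d) has_vector_derivative d * f' (w0 + of_real s * d) * cnj d) (at s)"
      by (rule has_vector_derivative_mult_left)
    then show ?thesis
      unfolding has_vector_derivative_complex_iff h_def by (simp add: mult_ac)
  qed
  obtain s where s: "0 < s" "s < 1"
      "h 1 - h 0 = (1 - 0) * Im (f' (w0 + of_real s * d) * d * cnj d)"
    using MVT2[of 0 1 h "\<lambda>s. Im (f' (w0 + of_real s * d) * d * cnj d)"] h' by auto
  have "Im (f' (w0 + of_real s * d) * d * cnj d) = (norm d)\<^sup>2 * Im (f' (w0 + of_real s * d))"
    by (subst mult.assoc, subst complex_norm_square[symmetric]) (simp add: mult.commute)
  moreover have "h 1 - h 0 = Im ((f w - f w0) * cnj d)"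
    unfolding h_def d_def by (simp add: algebra_simps)
  ultimately show ?thesis
    using that[of "w0 + of_real s * d"] seg[of s] s unfolding d_def by auto
qed

section \<open>Reparametrisation of crossings\<close>

lemma crosses_rl_reflect:
  assumes "crosses_lr (\<lambda>p. C (- p)) (- p0) \<omega>"
  shows "crosses_rl C p0 \<omega>"
proof -
  obtain e L where w: "\<omega> > 0" "e > 0" "L (- p0) = \<i> * complex_of_real \<omega>"
    "continuous_on {- p0 - e..- p0 + e} L"
    "\<forall>p\<in>{- p0 - e..- p0 + e}. C (- p) (L p) = 0"
    "\<forall>p\<in>{- p0 - e<..<- p0}. Re (L p) < 0"
    "\<forall>p\<in>{- p0<..<- p0 + e}. Re (L p) > 0"
    using assms unfolding crosses_lr_def by blast
  have "continuous_on {p0 - e..p0 + e} (\<lambda>p. L (- p))"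
    by (rule continuous_on_compose2[OF w(4)]) (auto intro!: continuous_intros)
  moreover have "\<forall>p\<in>{p0 - e..p0 + e}. C p (L (- p)) = 0"
  proof
    fix p
    assume "p \<in> {p0 - e..p0 + e}"
    then have "- p \<in> {- p0 - e..- p0 + e}"
      by auto
    then show "C p (L (- p)) = 0"
      using w(5) by (metis minus_minus)
  qed
  ultimately show ?thesis
    unfolding crosses_rl_def using w
    by (intro conjI exI[of _ e] exI[of _ "\<lambda>p. L (- p)"]) auto
qed

lemma crosses_lr_reparam:
  fixes q :: "real \<Rightarrow> real"
  assumes cr: "crosses_lr C' t0 \<omega>" and t0: "t1 < t0" "t0 < t2"
    and cont: "continuous_on {t1..t2} q"
    and rq: "\<And>t. t \<in> {t1..t2} \<Longrightarrow> r (q t) = t"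
    and eq: "\<And>t z. t \<in> {t1..t2} \<Longrightarrow> C (q t) z = C' t z"
    and mono: "\<And>s t. s \<in> {t1..t2} \<Longrightarrow> t \<in> {t1..t2} \<Longrightarrow> s < t \<Longrightarrow> q s < q t"
  shows "crosses_lr C (q t0) \<omega>"
proof -
  obtain e L where w: "\<omega> > 0" "e > 0" "L t0 = \<i> * complex_of_real \<omega>"
    "continuous_on {t0 - e..t0 + e} L"
    "\<forall>p\<in>{t0 - e..t0 + e}. C' p (L p) = 0"
    "\<forall>p\<in>{t0 - e<..<t0}. Re (L p) < 0"
    "\<forall>p\<in>{t0<..<t0 + e}. Re (L p) > 0"
    using cr unfolding crosses_lr_def by blast
  define d where "d = min (e / 2) (min (t0 - t1) (t2 - t0))"
  have d: "d > 0" "d < e" "t1 \<le> t0 - d" "t0 + d \<le> t2"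
    unfolding d_def using w(2) t0 by auto
  define J where "J = {t0 - d..t0 + d}"
  have J: "J \<subseteq> {t1..t2}" "J \<subseteq> {t0 - e..t0 + e}"
    unfolding J_def using d by auto
  define \<epsilon> where "\<epsilon> = min (q t0 - q (t0 - d)) (q (t0 + d) - q t0)"
  have eps: "\<epsilon> > 0" "q (t0 - d) \<le> q t0 - \<epsilon>" "q t0 + \<epsilon> \<le> q (t0 + d)"
    unfolding \<epsilon>_def using mono[of "t0 - d" t0] mono[of t0 "t0 + d"] d t0 by auto
  have inv: "\<exists>t\<in>J. q t = p \<and> r p = t" if p: "p \<in> {q t0 - \<epsilon>..q t0 + \<epsilon>}" for p
  proof -
    have "continuous_on J q"
      using cont J(1) by (rule continuous_on_subset)
    then obtain t where "t0 - d \<le> t" "t \<le> t0 + d" "q t = p"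
      using IVT'[of q "t0 - d" p "t0 + d"] p eps d(1) unfolding J_def by auto
    then show ?thesis
      using rq J(1) unfolding J_def by fastforce
  qed
  have qless: "q s < q t \<longleftrightarrow> s < t" if "s \<in> J" "t \<in> J" for s t
    using mono[of s t] mono[of t s] J(1) that by (metis linorder_cases order_less_asym order_less_irrefl subsetD)
  have t0J: "t0 \<in> J"
    unfolding J_def using d(1) by simp
  have "continuous_on (q ` J) r"
    by (rule continuous_on_inv) (use J rq continuous_on_subset[OF cont J(1)] in \<open>auto simp: J_def\<close>)
  then have "continuous_on {q t0 - \<epsilon>..q t0 + \<epsilon>} r"
    by (rule continuous_on_subset) (use inv in blast)
  then have c1: "continuous_on {q t0 - \<epsilon>..q t0 + \<epsilon>} (\<lambda>p. L (r p))"
    by (rule continuous_on_compose2[OF w(4)]) (use inv J(2) in blast)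
  have c2: "C p (L (r p)) = 0" if "p \<in> {q t0 - \<epsilon>..q t0 + \<epsilon>}" for p
    using inv[OF that] eq w(5) J by (metis subsetD)
  have c3: "Re (L (r p)) < 0" if p: "p \<in> {q t0 - \<epsilon><..<q t0}" for p
  proof -
    obtain t where t: "t \<in> J" "q t = p" "r p = t"
      using inv[of p] p eps(1) by auto
    then have "t < t0"
      using qless[OF t(1) t0J] p by auto
    then show ?thesis
      using t w(6) d unfolding J_def by auto
  qed
  have c4: "Re (L (r p)) > 0" if p: "p \<in> {q t0<..<q t0 + \<epsilon>}" for p
  proof -
    obtain t where t: "t \<in> J" "q t = p" "r p = t"
      using inv[of p] p eps(1) by auto
    then have "t0 < t"
      using qless[OF t0J t(1)] p by auto
    then show ?thesis
      using t w(7) d unfolding J_def by auto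
  qed
  have "r (q t0) = t0"
    using rq t0 by simp
  then show ?thesis
    unfolding crosses_lr_def using w(1,3) eps(1) c1 c2 c3 c4
    by (intro conjI exI[of _ \<epsilon>] exI[of _ "\<lambda>p. L (r p)"]) auto
qed

lemma crosses_rl_reparam:
  fixes q :: "real \<Rightarrow> real"
  assumes cr: "crosses_lr C' t0 \<omega>" and t0: "t1 < t0" "t0 < t2"
    and cont: "continuous_on {t1..t2} q"
    and rq: "\<And>t. t \<in> {t1..t2} \<Longrightarrow> r (q t) = t"
    and eq: "\<And>t z. t \<in> {t1..t2} \<Longrightarrow> C (q t) z = C' t z"
    and anti: "\<And>s t. s \<in> {t1..t2} \<Longrightarrow> t \<in> {t1..t2} \<Longrightarrow> s < t \<Longrightarrow> q t < q s"
  shows "crosses_rl C (q t0) \<omega>"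
proof (rule crosses_rl_reflect)
  show "crosses_lr (\<lambda>p. C (- p)) (- q t0) \<omega>"
    by (rule crosses_lr_reparam[OF cr t0, of "\<lambda>t. - q t" "\<lambda>p. r (- p)"])
       (use rq eq anti cont in \<open>auto intro!: continuous_intros\<close>)
qed

section \<open>Crossings of the characteristic values\<close>

text \<open>The characteristic function at a steady state, with \<open>B = -A\<close>.\<close>

definition char_red :: "real \<Rightarrow> real \<Rightarrow> real \<Rightarrow> real \<Rightarrow> complex \<Rightarrow> complex" where
  "char_red \<mu> \<gamma> \<tau> B z = z + of_real \<gamma> + of_real B * (1 - exp (- z * of_real \<tau>))
     + of_real \<mu> * of_real B * integral {-\<tau>..0} (\<lambda>s. exp (z * of_real s))"

lemma integral_exp_complex:
  fixes z :: complex
  assumes "\<tau> \<ge> 0"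
  shows "z * integral {-\<tau>..0} (\<lambda>s. exp (z * of_real s)) = 1 - exp (- z * of_real \<tau>)"
proof -
  have "((\<lambda>s. z * exp (z * of_real s)) has_integral exp (z * of_real 0) - exp (z * of_real (-\<tau>))) {-\<tau>..0}"
  proof (rule fundamental_theorem_of_calculus)
    fix s
    have "((\<lambda>w. exp (z * w)) has_field_derivative z * exp (z * of_real s)) (at (of_real s))"
      by (auto intro!: derivative_eq_intros)
    then have "((\<lambda>s. exp (z * of_real s)) has_vector_derivative z * exp (z * of_real s)) (at s)"
      using has_vector_derivative_real_field by blast
    then show "((\<lambda>s. exp (z * of_real s)) has_vector_derivative z * exp (z * of_real s)) (at s within {-\<tau>..0})"
      by (rule has_vector_derivative_at_within)
  qed (use assms in auto)
  then have "integral {-\<tau>..0} (\<lambda>s. z * exp (z * of_real s)) = 1 - exp (- z * of_real \<tau>)"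
    by (subst integral_unique) auto
  then show ?thesis
    unfolding integral_mult_right .
qed

lemma char_red_times:
  assumes "\<tau> \<ge> 0"
  shows "z * char_red \<mu> \<gamma> \<tau> B z
    = z * (z + of_real \<gamma>) + of_real B * (z + of_real \<mu>) * (1 - exp (- z * of_real \<tau>))"
  unfolding char_red_def integral_exp_complex[OF assms, symmetric] by (simp add: algebra_simps)

definition freq_sq :: "real \<Rightarrow> real \<Rightarrow> real \<Rightarrow> real" where
  "freq_sq \<mu> \<gamma> B = 2 * B * (\<mu> - \<gamma>) - \<gamma>\<^sup>2"

definition phase :: "real \<Rightarrow> real \<Rightarrow> real \<Rightarrow> real \<Rightarrow> real" where
  "phase \<mu> \<gamma> \<tau> B = sqrt (freq_sq \<mu> \<gamma> B) * \<tau>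
     + 2 * arctan (sqrt (freq_sq \<mu> \<gamma> B) / (2 * B + \<gamma>))"

definition char_quad :: "real \<Rightarrow> real \<Rightarrow> real \<Rightarrow> complex \<Rightarrow> complex" where
  "char_quad \<mu> \<gamma> B z = z * (z + of_real \<gamma>) + of_real B * (z + of_real \<mu>)"

lemma cis_double_arctan:
  assumes "D > 0"
  shows "cis (2 * arctan (w / D)) = (of_real D + \<i> * of_real w) / (of_real D - \<i> * of_real w)"
proof -
  have pos: "D\<^sup>2 + w\<^sup>2 > 0"
    using assms by (simp add: pos_add_strict add_pos_nonneg)
  have nz: "complex_of_real D - \<i> * of_real w \<noteq> 0" "complex_of_real D + \<i> * of_real w \<noteq> 0"
    using assms by (auto simp: complex_eq_iff)
  have s: "sqrt (1 + (w / D)\<^sup>2) = sqrt (D\<^sup>2 + w\<^sup>2) / D"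
  proof -
    have "1 + (w / D)\<^sup>2 = (D\<^sup>2 + w\<^sup>2) / D\<^sup>2"
      using assms by (simp add: field_simps power2_eq_square)
    then show ?thesis
      using assms by (simp add: real_sqrt_divide)
  qed
  have "cis (arctan (w / D)) = (of_real D + \<i> * of_real w) / of_real (sqrt (D\<^sup>2 + w\<^sup>2))"
    unfolding complex_eq_iff cis.sel cos_arctan sin_arctan s using assms by simp
  then have "cis (2 * arctan (w / D)) = (of_real D + \<i> * of_real w) * (of_real D + \<i> * of_real w)
      / (of_real (sqrt (D\<^sup>2 + w\<^sup>2)) * of_real (sqrt (D\<^sup>2 + w\<^sup>2)))"
    unfolding mult_2 cis_mult[symmetric] by (simp only: times_divide_times_eq)
  also have "complex_of_real (sqrt (D\<^sup>2 + w\<^sup>2)) * of_real (sqrt (D\<^sup>2 + w\<^sup>2)) = of_real (D\<^sup>2 + w\<^sup>2)"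
    using pos by (simp flip: of_real_mult of_real_power)
  also have "complex_of_real (D\<^sup>2 + w\<^sup>2) = (of_real D + \<i> * of_real w) * (of_real D - \<i> * of_real w)"
    by (simp add: complex_eq_iff power2_eq_square)
  finally show ?thesis
    using nz by simp
qed

lemma char_quad_unit:
  assumes "\<mu> > 0" "\<gamma> > 0" "B > 0" and w: "w\<^sup>2 = freq_sq \<mu> \<gamma> B"
  shows "char_quad \<mu> \<gamma> B (\<i> * of_real w) / (of_real B * (\<i> * of_real w + of_real \<mu>))
     = cis (2 * arctan (w / (2 * B + \<gamma>)))"
proof -
  have "char_quad \<mu> \<gamma> B (\<i> * of_real w) * (of_real (2 * B + \<gamma>) - \<i> * of_real w)
     = of_real B * (\<i> * of_real w + of_real \<mu>) * (of_real (2 * B + \<gamma>) + \<i> * of_real w)"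
  proof -
    have "w * w = 2 * B * (\<mu> - \<gamma>) - \<gamma> * \<gamma>"
      using w unfolding freq_sq_def power2_eq_square .
    then show ?thesis
      unfolding char_quad_def by (simp add: complex_eq_iff, algebra)
  qed
  moreover have "of_real B * (\<i> * of_real w + of_real \<mu>) \<noteq> 0" "of_real (2 * B + \<gamma>) - \<i> * of_real w \<noteq> 0"
    using assms(1-3) by (auto simp: complex_eq_iff)
  ultimately show ?thesis
    using assms(2,3) by (subst cis_double_arctan) (auto simp: frac_eq_eq)
qed

definition char_log :: "real \<Rightarrow> real \<Rightarrow> real \<Rightarrow> real \<Rightarrow> complex \<Rightarrow> complex" where
  "char_log \<mu> \<gamma> \<tau> B z = z * of_real \<tau> + Ln (char_quad \<mu> \<gamma> B z / (of_real B * (z + of_real \<mu>)))"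

definition char_log_deriv :: "real \<Rightarrow> real \<Rightarrow> real \<Rightarrow> real \<Rightarrow> complex \<Rightarrow> complex" where
  "char_log_deriv \<mu> \<gamma> \<tau> B z = of_real \<tau>
     + (2 * z + of_real \<gamma> + of_real B) / char_quad \<mu> \<gamma> B z - 1 / (z + of_real \<mu>)"

lemma char_log_imaginary:
  assumes "\<mu> > 0" "\<gamma> > 0" "B > 0" "freq_sq \<mu> \<gamma> B > 0"
  shows "char_log \<mu> \<gamma> \<tau> B (\<i> * of_real (sqrt (freq_sq \<mu> \<gamma> B))) = \<i> * of_real (phase \<mu> \<gamma> \<tau> B)"
proof -
  define w where "w = sqrt (freq_sq \<mu> \<gamma> B)"
  have w: "w > 0" "w\<^sup>2 = freq_sq \<mu> \<gamma> B"
    unfolding w_def using assms(4) by auto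
  define \<psi> where "\<psi> = 2 * arctan (w / (2 * B + \<gamma>))"
  have "-pi < \<psi>" "\<psi> < pi"
    unfolding \<psi>_def using arctan_bounded[of "w / (2 * B + \<gamma>)"] by auto
  then have "Ln (cis \<psi>) = \<i> * of_real \<psi>"
    unfolding cis_conv_exp by (intro Ln_exp) auto
  then show ?thesis
    unfolding char_log_def w_def[symmetric] char_quad_unit[OF assms(1-3) w(2)] phase_def
      \<psi>_def[symmetric] by (simp add: algebra_simps)
qed

lemma char_log_has_derivative:
  assumes "char_quad \<mu> \<gamma> B z / (of_real B * (z + of_real \<mu>)) \<notin> \<real>\<^sub>\<le>\<^sub>0" "B \<noteq> 0" "z + of_real \<mu> \<noteq> 0"
  shows "(char_log \<mu> \<gamma> \<tau> B has_field_derivative char_log_deriv \<mu> \<gamma> \<tau> B z) (at z)"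
proof -
  have Q: "char_quad \<mu> \<gamma> B z \<noteq> 0"
    using assms(1) by auto
  have d: "(char_quad \<mu> \<gamma> B has_field_derivative (2 * z + of_real \<gamma> + of_real B)) (at z)"
    unfolding char_quad_def[abs_def] by (auto intro!: derivative_eq_intros simp: algebra_simps)
  define R where "R = of_real B * (z + of_real \<mu>)"
  have R: "R \<noteq> 0"
    unfolding R_def using assms by simp
  have "((\<lambda>z. char_quad \<mu> \<gamma> B z / (of_real B * (z + of_real \<mu>))) has_field_derivative
      ((2 * z + of_real \<gamma> + of_real B) * R - char_quad \<mu> \<gamma> B z * of_real B) / (R * R)) (at z)"
    unfolding R_def by (rule DERIV_divide[OF d]) (use assms in \<open>auto intro!: derivative_eq_intros\<close>)
  then have "((\<lambda>z. Ln (char_quad \<mu> \<gamma> B z / (of_real B * (z + of_real \<mu>)))) has_field_derivative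
      inverse (char_quad \<mu> \<gamma> B z / R) *
        (((2 * z + of_real \<gamma> + of_real B) * R - char_quad \<mu> \<gamma> B z * of_real B) / (R * R))) (at z)"
    using has_field_derivative_Ln[OF assms(1)] unfolding R_def by (intro DERIV_chain2)
  moreover have "inverse (char_quad \<mu> \<gamma> B z / R) *
        (((2 * z + of_real \<gamma> + of_real B) * R - char_quad \<mu> \<gamma> B z * of_real B) / (R * R))
      = (2 * z + of_real \<gamma> + of_real B) / char_quad \<mu> \<gamma> B z - of_real B / R"
    using Q R by (simp add: field_simps)
  moreover have "of_real B / R = 1 / (z + of_real \<mu>)"
    unfolding R_def using assms by simp
  ultimately have ln: "((\<lambda>z. Ln (char_quad \<mu> \<gamma> B z / (of_real B * (z + of_real \<mu>)))) has_field_derivative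
      (2 * z + of_real \<gamma> + of_real B) / char_quad \<mu> \<gamma> B z - 1 / (z + of_real \<mu>)) (at z)"
    by metis
  have "((\<lambda>z. z * of_real \<tau>) has_field_derivative of_real \<tau>) (at z)"
    by (auto intro!: derivative_eq_intros)
  from DERIV_add[OF this ln] show ?thesis
    unfolding char_log_def[abs_def] char_log_deriv_def add_diff_eq .
qed

lemma Im_char_log_deriv_imaginary:
  assumes "\<mu> > 0" "\<gamma> > 0" "B > 0" "w > 0" and w: "w\<^sup>2 = freq_sq \<mu> \<gamma> B"
  shows "Im (char_log_deriv \<mu> \<gamma> \<tau> B (\<i> * of_real w)) < 0"
proof -
  define a b where "a = B * \<mu> - w\<^sup>2" and "b = w * (\<gamma> + B)"
  have Q: "char_quad \<mu> \<gamma> B (\<i> * of_real w) = Complex a b"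
    unfolding char_quad_def a_def b_def by (simp add: complex_eq_iff power2_eq_square algebra_simps)
  have ab: "a\<^sup>2 + b\<^sup>2 = B\<^sup>2 * (w\<^sup>2 + \<mu>\<^sup>2)"
    unfolding a_def b_def power_mult_distrib power2_diff w freq_sq_def
    by (simp add: power2_eq_square algebra_simps)
  have "w\<^sup>2 + \<mu>\<^sup>2 > 0"
    using \<open>w > 0\<close> by (simp add: add_pos_nonneg)
  have "Im (char_log_deriv \<mu> \<gamma> \<tau> B (\<i> * of_real w))
     = (2 * w * a - (\<gamma> + B) * b) / (a\<^sup>2 + b\<^sup>2) + w / (w\<^sup>2 + \<mu>\<^sup>2)"
    unfolding char_log_deriv_def Q
    by (simp add: Im_divide add.commute)
  also have "\<dots> = w * (2 * a - (\<gamma> + B)\<^sup>2 + B\<^sup>2) / (B\<^sup>2 * (w\<^sup>2 + \<mu>\<^sup>2))"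
  proof -
    have "2 * w * a - (\<gamma> + B) * b = w * (2 * a - (\<gamma> + B)\<^sup>2)"
      unfolding b_def by (simp add: algebra_simps power2_eq_square)
    moreover have "w / (w\<^sup>2 + \<mu>\<^sup>2) = w * B\<^sup>2 / (B\<^sup>2 * (w\<^sup>2 + \<mu>\<^sup>2))"
      using \<open>B > 0\<close> by simp
    ultimately show ?thesis
      unfolding ab by (simp only: add_divide_distrib[symmetric] distrib_left)
  qed
  also have "2 * a - (\<gamma> + B)\<^sup>2 + B\<^sup>2 = - w\<^sup>2"
    using w unfolding a_def freq_sq_def by (simp add: power2_eq_square algebra_simps)
  also have "w * (- w\<^sup>2) / (B\<^sup>2 * (w\<^sup>2 + \<mu>\<^sup>2)) < 0"
    using \<open>w > 0\<close> \<open>B > 0\<close> \<open>w\<^sup>2 + \<mu>\<^sup>2 > 0\<close>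
    by (intro divide_neg_pos mult_pos_neg mult_pos_pos) auto
  finally show ?thesis .
qed

lemma char_red_eq_0_if_char_log:
  assumes "char_log \<mu> \<gamma> \<tau> B z = 2 * of_nat n * of_real pi * \<i>"
    and "char_quad \<mu> \<gamma> B z \<noteq> 0" "B \<noteq> 0" "z + of_real \<mu> \<noteq> 0" "z \<noteq> 0" "\<tau> \<ge> 0"
  shows "char_red \<mu> \<gamma> \<tau> B z = 0"
proof -
  define R where "R = of_real B * (z + of_real \<mu>)"
  have R: "R \<noteq> 0"
    unfolding R_def using assms by simp
  have "exp (char_log \<mu> \<gamma> \<tau> B z) = exp (z * of_real \<tau>) * (char_quad \<mu> \<gamma> B z / R)"
    unfolding char_log_def R_def[symmetric] using assms(2) R by (simp add: exp_add)
  moreover have "exp (char_log \<mu> \<gamma> \<tau> B z) = 1"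
    unfolding assms(1) exp_eq_1 by (auto intro!: exI[of _ "int n"])
  ultimately have "exp (z * of_real \<tau>) * char_quad \<mu> \<gamma> B z = R"
    using R by (simp add: field_simps)
  then have "char_quad \<mu> \<gamma> B z = R * exp (- z * of_real \<tau>)"
    by (auto simp: exp_minus field_simps)
  then have "z * char_red \<mu> \<gamma> \<tau> B z = 0"
    unfolding char_red_times[OF assms(6)] char_quad_def R_def by (simp add: algebra_simps)
  then show ?thesis
    using assms(5) by simp
qed

lemma tendsto_char_quad:
  assumes "(\<gamma> \<longlongrightarrow> \<gamma>0) F" "(B \<longlongrightarrow> B0) F" "(z \<longlongrightarrow> z0) F"
  shows "((\<lambda>x. char_quad \<mu> (\<gamma> x) (B x) (z x)) \<longlongrightarrow> char_quad \<mu> \<gamma>0 B0 z0) F"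
  unfolding char_quad_def by (intro tendsto_intros assms)

lemma tendsto_char_log:
  assumes "(\<gamma> \<longlongrightarrow> \<gamma>0) F" "(\<tau> \<longlongrightarrow> \<tau>0) F" "(B \<longlongrightarrow> B0) F" "(z \<longlongrightarrow> z0) F"
    and "B0 \<noteq> 0" "z0 + of_real \<mu> \<noteq> 0"
    and "char_quad \<mu> \<gamma>0 B0 z0 / (of_real B0 * (z0 + of_real \<mu>)) \<notin> \<real>\<^sub>\<le>\<^sub>0"
  shows "((\<lambda>x. char_log \<mu> (\<gamma> x) (\<tau> x) (B x) (z x)) \<longlongrightarrow> char_log \<mu> \<gamma>0 \<tau>0 B0 z0) F"
  unfolding char_log_def by (intro tendsto_intros tendsto_char_quad assms) (use assms in auto)

lemma tendsto_char_log_deriv: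
  assumes "(\<gamma> \<longlongrightarrow> \<gamma>0) F" "(\<tau> \<longlongrightarrow> \<tau>0) F" "(B \<longlongrightarrow> B0) F" "(z \<longlongrightarrow> z0) F"
    and "z0 + of_real \<mu> \<noteq> 0" "char_quad \<mu> \<gamma>0 B0 z0 \<noteq> 0"
  shows "((\<lambda>x. char_log_deriv \<mu> (\<gamma> x) (\<tau> x) (B x) (z x)) \<longlongrightarrow> char_log_deriv \<mu> \<gamma>0 \<tau>0 B0 z0) F"
  unfolding char_log_deriv_def by (intro tendsto_intros tendsto_char_quad assms)

lemma crosses_lr_local:
  fixes \<mu> :: real and \<gamma> \<tau> B :: "real \<Rightarrow> real" and n :: nat
  defines "E \<equiv> \<lambda>t. phase \<mu> (\<gamma> t) (\<tau> t) (B t) - 2 * real n * pi"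
  assumes \<mu>: "\<mu> > 0" and t0: "a < t0" "t0 < b"
    and cont: "continuous_on {a..b} \<gamma>" "continuous_on {a..b} \<tau>" "continuous_on {a..b} B"
    and pos: "\<And>t. t \<in> {a..b} \<Longrightarrow> \<gamma> t > 0" "\<And>t. t \<in> {a..b} \<Longrightarrow> \<tau> t > 0" "\<And>t. t \<in> {a..b} \<Longrightarrow> B t > 0"
      "\<And>t. t \<in> {a..b} \<Longrightarrow> freq_sq \<mu> (\<gamma> t) (B t) > 0"
    and E0: "E t0 = 0" and Eneg: "\<And>t. t \<in> {a..<t0} \<Longrightarrow> E t < 0" and Epos: "\<And>t. t \<in> {t0<..b} \<Longrightarrow> E t > 0"
  shows "crosses_lr (\<lambda>t. char_red \<mu> (\<gamma> t) (\<tau> t) (B t)) t0 (sqrt (freq_sq \<mu> (\<gamma> t0) (B t0)))"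
proof -
  define W where "W t = sqrt (freq_sq \<mu> (\<gamma> t) (B t))" for t
  define z0 where "z0 = \<i> * complex_of_real (W t0)"
  define F where "F = nhds t0 \<times>\<^sub>F nhds z0"
  define g where "g t z = char_log \<mu> (\<gamma> t) (\<tau> t) (B t) z - 2 * of_nat n * of_real pi * \<i>" for t z
  define g' where "g' t z = char_log_deriv \<mu> (\<gamma> t) (\<tau> t) (B t) z" for t z
  define h where "h t z = char_quad \<mu> (\<gamma> t) (B t) z / (of_real (B t) * (z + of_real \<mu>))" for t z
  have W: "W t > 0" "(W t)\<^sup>2 = freq_sq \<mu> (\<gamma> t) (B t)" if "t \<in> {a..b}" for t
    unfolding W_def using pos(4)[OF that] by auto
  have giW: "g t (\<i> * of_real (W t)) = \<i> * of_real (E t)" if "t \<in> {a..b}" for t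
    unfolding g_def E_def W_def using char_log_imaginary[OF \<mu> pos(1)[OF that] pos(3)[OF that] pos(4)[OF that]]
    by (simp add: algebra_simps)
  have t0ab: "t0 \<in> {a..b}" "t0 \<in> interior {a..b}"
    using t0 by auto
  have lim: "(\<gamma> \<longlongrightarrow> \<gamma> t0) (nhds t0)" "(\<tau> \<longlongrightarrow> \<tau> t0) (nhds t0)" "(B \<longlongrightarrow> B t0) (nhds t0)"
    using continuous_on_interior[OF cont(1) t0ab(2)] continuous_on_interior[OF cont(2) t0ab(2)]
      continuous_on_interior[OF cont(3) t0ab(2)]
    by (simp_all add: continuous_at tendsto_at_iff_tendsto_nhds)
  have limW: "(W \<longlongrightarrow> W t0) (nhds t0)"
    unfolding W_def freq_sq_def by (intro tendsto_intros lim)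
  have fst: "filterlim fst (nhds t0) F" and snd: "filterlim snd (nhds z0) F"
    unfolding F_def by (rule filterlim_fst, rule filterlim_snd)
  note limF = filterlim_compose[OF lim(1) fst] filterlim_compose[OF lim(2) fst] filterlim_compose[OF lim(3) fst]
  have z0\<mu>: "z0 + of_real \<mu> \<noteq> 0" "z0 \<noteq> 0" and B0: "B t0 \<noteq> 0"
    unfolding z0_def using \<mu> W(1)[OF t0ab(1)] pos(3)[OF t0ab(1)] by (auto simp: complex_eq_iff)
  have Imh0: "Im (h t0 z0) > 0"
  proof -
    define x where "x = W t0 / (2 * B t0 + \<gamma> t0)"
    have "x > 0"
      unfolding x_def using W(1) pos(1,3) t0ab(1) by (simp add: add_pos_pos)
    then have "0 < 2 * arctan x" "2 * arctan x < pi"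
      using arctan_bounded[of x] by auto
    then have "sin (2 * arctan x) > 0"
      by (rule sin_gt_zero)
    moreover have "h t0 z0 = cis (2 * arctan x)"
      unfolding h_def z0_def x_def using char_quad_unit[OF \<mu> pos(1)[OF t0ab(1)] pos(3)[OF t0ab(1)] W(2)[OF t0ab(1)]] .
    ultimately show ?thesis
      by simp
  qed
  have Q0: "char_quad \<mu> (\<gamma> t0) (B t0) z0 \<noteq> 0"
    using Imh0 unfolding h_def by auto
  define c where "c = g' t0 z0"
  have Imc: "Im c < 0"
    unfolding c_def g'_def z0_def
    by (rule Im_char_log_deriv_imaginary[OF \<mu> pos(1)[OF t0ab(1)] pos(3)[OF t0ab(1)] W(1)[OF t0ab(1)] W(2)[OF t0ab(1)]])
  then have c0: "c \<noteq> 0"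
    by auto
  have limh: "((\<lambda>p. h (fst p) (snd p)) \<longlongrightarrow> h t0 z0) F"
    unfolding h_def by (intro tendsto_intros tendsto_char_quad limF snd) (use z0\<mu> B0 in auto)
  have limg': "((\<lambda>p. g' (fst p) (snd p)) \<longlongrightarrow> c) F"
    unfolding g'_def c_def by (intro tendsto_char_log_deriv limF snd z0\<mu> Q0)
  have limg: "((\<lambda>t. g t z0) \<longlongrightarrow> g t0 z0) (nhds t0)"
    unfolding g_def using Imh0 unfolding h_def
    by (intro tendsto_intros tendsto_char_log lim z0\<mu> B0) (auto simp: complex_nonpos_Reals_iff)
  have "\<forall>\<^sub>F p in F. Im (h (fst p) (snd p)) > 0 \<and> snd p + of_real \<mu> \<noteq> 0 \<and> snd p \<noteq> 0
      \<and> norm (g' (fst p) (snd p) - c) < norm c / 2 \<and> Im (g' (fst p) (snd p)) < 0"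
  proof (intro eventually_conj)
    show "\<forall>\<^sub>F p in F. Im (h (fst p) (snd p)) > 0"
      using order_tendstoD(1)[OF tendsto_Im[OF limh] Imh0] .
    show "\<forall>\<^sub>F p in F. snd p + of_real \<mu> \<noteq> 0"
      by (rule tendsto_imp_eventually_ne[OF tendsto_add[OF snd tendsto_const] z0\<mu>(1)])
    show "\<forall>\<^sub>F p in F. snd p \<noteq> 0"
      by (rule tendsto_imp_eventually_ne[OF snd z0\<mu>(2)])
    show "\<forall>\<^sub>F p in F. norm (g' (fst p) (snd p) - c) < norm c / 2"
      using tendstoD[OF limg', of "norm c / 2"] c0 by (simp add: dist_norm)
    show "\<forall>\<^sub>F p in F. Im (g' (fst p) (snd p)) < 0"
      using order_tendstoD(2)[OF tendsto_Im[OF limg'] Imc] .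
  qed
  then obtain Pt Pz where Pt: "eventually Pt (nhds t0)" and Pz: "eventually Pz (nhds z0)"
    and P: "\<And>t z. Pt t \<Longrightarrow> Pz z \<Longrightarrow> Im (h t z) > 0 \<and> z + of_real \<mu> \<noteq> 0 \<and> z \<noteq> 0
      \<and> norm (g' t z - c) < norm c / 2 \<and> Im (g' t z) < 0"
    unfolding F_def eventually_prod_filter by auto
  obtain d where d: "d > 0" "\<And>z. dist z z0 < d \<Longrightarrow> Pz z"
    using Pz unfolding eventually_nhds_metric by blast
  define r where "r = d / 2"
  have r: "r > 0" "\<And>z. z \<in> cball z0 r \<Longrightarrow> Pz z"
    unfolding r_def using d by (auto simp: dist_commute)
  have "\<forall>\<^sub>F t in nhds t0. Pt t \<and> norm (g t z0) < norm c * r / 2 \<and> dist (\<i> * of_real (W t)) z0 < r \<and> t \<in> {a<..<b}"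
  proof (intro eventually_conj Pt)
    have "g t0 z0 = 0"
      unfolding z0_def giW[OF t0ab(1)] E0 by simp
    then show "\<forall>\<^sub>F t in nhds t0. norm (g t z0) < norm c * r / 2"
      using tendstoD[OF limg, of "norm c * r / 2"] c0 r(1) by simp
    have "((\<lambda>t. \<i> * complex_of_real (W t)) \<longlongrightarrow> z0) (nhds t0)"
      unfolding z0_def by (intro tendsto_intros limW)
    then show "\<forall>\<^sub>F t in nhds t0. dist (\<i> * of_real (W t)) z0 < r"
      using r(1) by (rule tendstoD)
    show "\<forall>\<^sub>F t in nhds t0. t \<in> {a<..<b}"
      using t0 by (intro eventually_nhds_in_open) auto
  qed
  then obtain e' where e': "e' > 0" "\<And>t. dist t t0 < e' \<Longrightarrow> Pt t \<and> norm (g t z0) < norm c * r / 2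
      \<and> dist (\<i> * of_real (W t)) z0 < r \<and> t \<in> {a<..<b}"
    unfolding eventually_nhds_metric by blast
  define e where "e = e' / 2"
  define I where "I = {t0 - e..t0 + e}"
  have "e > 0"
    unfolding e_def using e'(1) by simp
  have I: "Pt t" "norm (g t z0) < norm c * r / 2" "\<i> * of_real (W t) \<in> cball z0 r" "t \<in> {a..b}" if "t \<in> I" for t
  proof -
    have "dist t t0 < e'"
      using that e'(1) unfolding I_def e_def dist_real_def by (auto simp: abs_if)
    from e'(2)[OF this] show "Pt t" "norm (g t z0) < norm c * r / 2" "\<i> * of_real (W t) \<in> cball z0 r" "t \<in> {a..b}"
      by (auto simp: dist_commute)
  qed
  note PI = P[OF I(1) r(2)]
  have nonpos: "h t z \<notin> \<real>\<^sub>\<le>\<^sub>0" if "t \<in> I" "z \<in> cball z0 r" for t z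
    using PI[OF that] by (auto simp: complex_nonpos_Reals_iff)
  have Bnz: "B t \<noteq> 0" if "t \<in> I" for t
    using pos(3)[OF I(4)[OF that]] by simp
  have der: "(char_log \<mu> (\<gamma> t) (\<tau> t) (B t) has_field_derivative g' t z) (at z)"
    if "t \<in> I" "z \<in> cball z0 r" for t z
    unfolding g'_def using char_log_has_derivative nonpos[OF that, unfolded h_def] Bnz[OF that(1)] PI[OF that] by blast
  obtain L where L: "continuous_on I L" "\<And>t. t \<in> I \<Longrightarrow> L t \<in> cball z0 r" "\<And>t. t \<in> I \<Longrightarrow> g t (L t) = 0"
  proof (rule continuous_root_branch[OF r(1) c0, of I z0 g g'])
    fix t z
    assume tz: "t \<in> I" "z \<in> cball z0 r"
    show "(g t has_field_derivative g' t z) (at z)"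
      unfolding g_def[abs_def] using DERIV_diff[OF der[OF tz] DERIV_const] by simp
    show "norm (g' t z - c) \<le> norm c / 2"
      using PI[OF tz] by simp
  next
    fix z
    assume z: "z \<in> cball z0 r"
    have "I \<subseteq> {a..b}"
      using I(4) by blast
    note contI = cont[THEN continuous_on_subset, OF this]
    show "continuous_on I (\<lambda>t. g t z)"
      unfolding continuous_on_def g_def
    proof (intro ballI tendsto_diff tendsto_const tendsto_char_log)
      fix t
      assume t: "t \<in> I"
      show "(\<gamma> \<longlongrightarrow> \<gamma> t) (at t within I)" "(\<tau> \<longlongrightarrow> \<tau> t) (at t within I)" "(B \<longlongrightarrow> B t) (at t within I)"
        using contI t unfolding continuous_on_def by auto
      show "B t \<noteq> 0" "z + of_real \<mu> \<noteq> 0"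
        using Bnz[OF t] PI[OF t z] by auto
      show "char_quad \<mu> (\<gamma> t) (B t) z / (of_real (B t) * (z + of_real \<mu>)) \<notin> \<real>\<^sub>\<le>\<^sub>0"
        using nonpos[OF t z] unfolding h_def .
    qed
  qed (use I(2) in \<open>auto intro: less_imp_le\<close>)
  have sgn: "\<exists>k>0. E t * Re (L t) = (norm (L t - \<i> * of_real (W t)))\<^sup>2 * k" if t: "t \<in> I" for t
  proof -
    have seg: "closed_segment (\<i> * of_real (W t)) (L t) \<subseteq> cball z0 r"
      by (rule closed_segment_subset[OF I(3)[OF t] L(2)[OF t] convex_cball])
    obtain z where z: "z \<in> closed_segment (\<i> * of_real (W t)) (L t)"
      "Im ((char_log \<mu> (\<gamma> t) (\<tau> t) (B t) (L t) - char_log \<mu> (\<gamma> t) (\<tau> t) (B t) (\<i> * of_real (W t)))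
          * cnj (L t - \<i> * of_real (W t)))
       = (norm (L t - \<i> * of_real (W t)))\<^sup>2 * Im (g' t z)"
      using Im_derivative_mean_value[of "\<i> * of_real (W t)" "L t" "char_log \<mu> (\<gamma> t) (\<tau> t) (B t)" "g' t"]
        der[OF t] seg by blast
    have "char_log \<mu> (\<gamma> t) (\<tau> t) (B t) (L t) - char_log \<mu> (\<gamma> t) (\<tau> t) (B t) (\<i> * of_real (W t))
        = - \<i> * of_real (E t)"
      using L(3)[OF t] giW[OF I(4)[OF t]] unfolding g_def by (simp add: algebra_simps)
    then have "Im ((- \<i> * of_real (E t)) * cnj (L t - \<i> * of_real (W t)))
       = (norm (L t - \<i> * of_real (W t)))\<^sup>2 * Im (g' t z)"
      using z(2) by simp
    moreover have "Im ((- \<i> * of_real (E t)) * cnj (L t - \<i> * of_real (W t))) = - (E t * Re (L t))"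
      by simp
    moreover have "Im (g' t z) < 0"
      using PI[OF t] z(1) seg by blast
    ultimately show ?thesis
      by (intro exI[of _ "- Im (g' t z)"]) auto
  qed
  have ne: "L t \<noteq> \<i> * of_real (W t)" if "t \<in> I" "E t \<noteq> 0" for t
    using L(3)[OF that(1)] giW[OF I(4)[OF that(1)]] that(2) by auto
  have ERe: "E t * Re (L t) > 0" if t: "t \<in> I" "E t \<noteq> 0" for t
    using sgn[OF t(1)] ne[OF t] by auto
  have t0I: "t0 \<in> I"
    unfolding I_def using \<open>e > 0\<close> by simp
  have "L t0 = \<i> * of_real (W t0)"
    using sgn[OF t0I] E0 by auto
  moreover have "char_red \<mu> (\<gamma> t) (\<tau> t) (B t) (L t) = 0" if t: "t \<in> I" for t
  proof (rule char_red_eq_0_if_char_log)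
    show "char_log \<mu> (\<gamma> t) (\<tau> t) (B t) (L t) = 2 * of_nat n * of_real pi * \<i>"
      using L(3)[OF t] unfolding g_def by simp
    show "char_quad \<mu> (\<gamma> t) (B t) (L t) \<noteq> 0"
      using nonpos[OF t L(2)[OF t]] unfolding h_def by auto
    show "B t \<noteq> 0"
      by (rule Bnz[OF t])
    show "L t + of_real \<mu> \<noteq> 0" "L t \<noteq> 0"
      using PI[OF t L(2)[OF t]] by auto
    show "\<tau> t \<ge> 0"
      using pos(2)[OF I(4)[OF t]] by simp
  qed
  moreover have "Re (L t) < 0" if "t \<in> {t0 - e<..<t0}" for t
  proof -
    have "t \<in> I"
      using that unfolding I_def by auto
    moreover from this have "E t < 0"
      using Eneg[of t] I(4)[of t] that by auto
    ultimately show ?thesis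
      using ERe[of t] by (auto simp: zero_less_mult_iff)
  qed
  moreover have "Re (L t) > 0" if "t \<in> {t0<..<t0 + e}" for t
  proof -
    have "t \<in> I"
      using that unfolding I_def by auto
    moreover from this have "E t > 0"
      using Epos[of t] I(4)[of t] that by auto
    ultimately show ?thesis
      using ERe[of t] by (auto simp: zero_less_mult_iff)
  qed
  ultimately show ?thesis
    unfolding crosses_lr_def W_def[symmetric] using W(1)[OF t0ab(1)] \<open>e > 0\<close> L(1) unfolding I_def
    by (intro conjI exI[of _ e] exI[of _ L]) auto
qed

text \<open>The endpoint conditions say that the frequency is so small, respectively so large,
  that the phase \<open>2 (j + 1) \<pi>\<close> is attained in between.\<close>

theorem analytic_crossing:
  fixes \<gamma> \<tau> B :: "real \<Rightarrow> real"
  assumes \<mu>: "\<mu> > 0" and ab: "a < b"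
    and an: "\<gamma> real_analytic_on {a..b}" "\<tau> real_analytic_on {a..b}" "B real_analytic_on {a..b}"
    and pos: "\<And>t. t \<in> {a..b} \<Longrightarrow> \<gamma> t > 0" "\<And>t. t \<in> {a..b} \<Longrightarrow> \<tau> t > 0" "\<And>t. t \<in> {a..b} \<Longrightarrow> B t > 0"
    and left: "freq_sq \<mu> (\<gamma> a) (B a) * (\<tau> a)\<^sup>2 < pi\<^sup>2"
    and right: "freq_sq \<mu> (\<gamma> b) (B b) * (\<tau> b)\<^sup>2 > (2 * (real j + 1) * pi)\<^sup>2"
  obtains t0 \<omega> where "a < t0" "t0 < b"
    "crosses_lr (\<lambda>t. char_red \<mu> (\<gamma> t) (\<tau> t) (B t)) t0 \<omega>"
    "\<omega> * \<tau> t0 \<in> {(2 * real j + 1) * pi<..<(2 * real j + 2) * pi}"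
proof -
  define f where "f t = freq_sq \<mu> (\<gamma> t) (B t)" for t
  have fan: "f real_analytic_on {a..b}"
    unfolding f_def freq_sq_def power2_eq_square by (intro real_analytic_intros an)
  define k where "k t = f t * (\<tau> t * \<tau> t)" for t
  have "k real_analytic_on {a..b}"
    unfolding k_def by (intro real_analytic_intros an fan)
  then have kc: "continuous_on {a..b} k"
    by (rule real_analytic_on_imp_continuous_on)
  have ka: "k a < pi\<^sup>2" and kb: "k b > (2 * (real j + 1) * pi)\<^sup>2"
    using left right unfolding k_def f_def by (simp_all add: power2_eq_square)
  have "(2 * (real j + 1) * pi)\<^sup>2 \<ge> pi\<^sup>2"
    by (intro power_mono) (auto simp: mult_le_cancel_right1)
  with kb have kb': "k b > pi\<^sup>2"
    by linarith
  define X where "X = {t \<in> {a..b}. k t = pi\<^sup>2}"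
  have "compact X"
  proof -
    have "X = {a..b} \<inter> k -` {pi\<^sup>2}"
      unfolding X_def by auto
    then show ?thesis
      using continuous_closed_preimage[OF kc closed_atLeastAtMost closed_singleton]
      by (simp add: compact_eq_bounded_closed bounded_Int)
  qed
  moreover have "X \<noteq> {}"
    using IVT'[of k a "pi\<^sup>2" b] ka kb' ab kc unfolding X_def by auto
  ultimately obtain a' where a': "a' \<in> X" "\<And>t. t \<in> X \<Longrightarrow> t \<le> a'"
    using compact_attains_sup[of X] by auto
  have a'b: "a \<le> a'" "a' < b" "k a' = pi\<^sup>2"
  proof -
    show "a \<le> a'" "k a' = pi\<^sup>2"
      using a'(1) unfolding X_def by auto
    then show "a' < b"
      using a'(1) kb' unfolding X_def by (cases "a' = b") auto
  qed
  have kge: "k t \<ge> pi\<^sup>2" if t: "t \<in> {a'..b}" for t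
  proof (rule ccontr)
    assume "\<not> k t \<ge> pi\<^sup>2"
    then have "k t < pi\<^sup>2"
      by simp
    moreover have "continuous_on {t..b} k"
      by (rule continuous_on_subset[OF kc]) (use t a'b in auto)
    ultimately obtain s where s: "t \<le> s" "s \<le> b" "k s = pi\<^sup>2"
      using IVT'[of k t "pi\<^sup>2" b] kb' t by auto
    then have "s \<le> a'"
      using a'(2)[of s] t a'b unfolding X_def by auto
    then have "t = a'"
      using s t by auto
    then show False
      using \<open>k t < pi\<^sup>2\<close> a'b by simp
  qed
  have sub: "{a'..b} \<subseteq> {a..b}"
    using a'b by auto
  have fpos: "f t > 0" if "t \<in> {a'..b}" for t
  proof (rule ccontr)
    assume "\<not> f t > 0"
    then have "k t \<le> 0"
      unfolding k_def by (simp add: mult_nonpos_nonneg)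
    then show False
      using kge[OF that] pi_gt_zero by (smt (verit) zero_less_power)
  qed
  define E where "E t = phase \<mu> (\<gamma> t) (\<tau> t) (B t) - 2 * real (Suc j) * pi" for t
  have D: "2 * B t + \<gamma> t > 0" if "t \<in> {a'..b}" for t
    using pos(1,3)[of t] that sub by (auto simp: add_pos_pos)
  have sk: "sqrt (f t) * \<tau> t = sqrt (k t)" if "t \<in> {a'..b}" for t
    unfolding k_def using pos(2)[of t] that sub by (auto simp: real_sqrt_mult)
  have arct: "0 < arctan (sqrt (f t) / (2 * B t + \<gamma> t))" "arctan (sqrt (f t) / (2 * B t + \<gamma> t)) < pi / 2"
    if "t \<in> {a'..b}" for t
    using fpos[OF that] D[OF that] arctan_bounded[of "sqrt (f t) / (2 * B t + \<gamma> t)"] by auto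
  have Eeq: "E t = sqrt (k t) + 2 * arctan (sqrt (f t) / (2 * B t + \<gamma> t)) - 2 * (real j + 1) * pi"
    if "t \<in> {a'..b}" for t
    unfolding E_def phase_def f_def[symmetric] sk[OF that] by (simp add: algebra_simps)
  have Ean: "E real_analytic_on {a'..b}"
    unfolding E_def phase_def f_def[symmetric]
    by (intro real_analytic_intros an[THEN real_analytic_on_subset, OF sub]
          fan[THEN real_analytic_on_subset, OF sub] fpos)
       (use D in \<open>fastforce+\<close>)
  have "sqrt (k a') = pi"
    using a'b by simp
  moreover have "2 * (real j + 1) * pi \<ge> 2 * pi"
    by simp
  moreover have "a' \<in> {a'..b}"
    using a'b by simp
  ultimately have Ea: "E a' < 0"
    using Eeq[of a'] arct(2)[of a'] by linarith
  have "sqrt (k b) > 2 * (real j + 1) * pi"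
    using kb by (intro real_less_rsqrt)
  moreover have "b \<in> {a'..b}"
    using a'b by simp
  ultimately have Eb: "E b > 0"
    using Eeq[of b] arct(1)[of b] by linarith
  obtain p e where pe: "e > 0" "a' \<le> p - e" "p + e \<le> b" "E p = 0"
    "\<And>x. x \<in> {p - e..<p} \<Longrightarrow> E x < 0" "\<And>x. x \<in> {p<..p + e} \<Longrightarrow> E x > 0"
    by (rule real_analytic_sign_change[OF a'b(2) Ean Ea Eb]) (rule that; assumption)
  have p: "p \<in> {a'..b}" "a < p" "p < b"
    using pe(1-3) a'b by auto
  have sub': "{p - e..p + e} \<subseteq> {a..b}"
    using pe a'b by auto
  show ?thesis
  proof
    show "a < p" "p < b"
      by (rule p)+
    show "crosses_lr (\<lambda>t. char_red \<mu> (\<gamma> t) (\<tau> t) (B t)) p (sqrt (freq_sq \<mu> (\<gamma> p) (B p)))"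
    proof (rule crosses_lr_local[OF \<mu>, of "p - e" p "p + e", where n = "Suc j"])
      show "continuous_on {p - e..p + e} \<gamma>" "continuous_on {p - e..p + e} \<tau>" "continuous_on {p - e..p + e} B"
        using an[THEN real_analytic_on_subset, OF sub', THEN real_analytic_on_imp_continuous_on] .
      show "0 < freq_sq \<mu> (\<gamma> t) (B t)" if "t \<in> {p - e..p + e}" for t
        using fpos[of t] that pe unfolding f_def by auto
    qed (use pos sub' pe in \<open>auto simp: E_def[symmetric] simp del: of_nat_Suc\<close>)
    have "sqrt (freq_sq \<mu> (\<gamma> p) (B p)) * \<tau> p = 2 * (real j + 1) * pi - 2 * arctan (sqrt (f p) / (2 * B p + \<gamma> p))"
      using Eeq[OF p(1)] pe(4) sk[OF p(1)] unfolding f_def by simp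
    then show "sqrt (freq_sq \<mu> (\<gamma> p) (B p)) * \<tau> p \<in> {(2 * real j + 1) * pi<..<(2 * real j + 2) * pi}"
      using arct[OF p(1)] by (simp add: algebra_simps del: zero_less_arctan_iff)
  qed
qed

section \<open>Stability criteria for the characteristic function\<close>

lemma Re_one_minus_exp_nonneg:
  assumes "Re z \<ge> 0" "\<tau> \<ge> 0"
  shows "Re (1 - exp (- z * of_real \<tau>)) \<ge> 0"
proof -
  have "Re (exp (- z * of_real \<tau>)) \<le> norm (exp (- z * of_real \<tau>))"
    by (rule complex_Re_le_cmod)
  also have "\<dots> \<le> 1"
    using assms by (simp add: norm_exp_eq_Re)
  finally show ?thesis
    by simp
qed

lemma char_red_stable_small:
  assumes "\<mu> > 0" "\<tau> > 0" "B \<ge> 0" "B * \<mu> * \<tau> < \<gamma>" and root: "char_red \<mu> \<gamma> \<tau> B z = 0"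
  shows "Re z < 0"
proof (rule ccontr)
  assume "\<not> Re z < 0"
  then have z: "Re z \<ge> 0"
    by simp
  define K where "K = integral {-\<tau>..0} (\<lambda>s. exp (z * of_real s))"
  have "norm K \<le> 1 * (0 - (-\<tau>))"
    unfolding K_def
    by (rule integral_bound) (use assms z in \<open>auto intro!: continuous_intros mult_nonneg_nonpos simp: norm_exp_eq_Re\<close>)
  then have "\<bar>Re K\<bar> \<le> \<tau>"
    using order_trans[OF abs_Re_le_cmod[of K]] by simp
  then have "Re K \<ge> - \<tau>"
    by (simp add: abs_le_iff)
  then have "\<mu> * B * Re K \<ge> \<mu> * B * (- \<tau>)"
    using assms by (intro mult_left_mono) auto
  moreover have "B * Re (1 - exp (- z * of_real \<tau>)) \<ge> 0"
    using Re_one_minus_exp_nonneg[OF z, of \<tau>] assms by (intro mult_nonneg_nonneg) auto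
  moreover have "Re (char_red \<mu> \<gamma> \<tau> B z) = Re z + \<gamma> + B * Re (1 - exp (- z * of_real \<tau>)) + \<mu> * B * Re K"
    unfolding char_red_def K_def[symmetric] by simp
  ultimately show False
    using root z assms(4) by (simp add: mult_ac)
qed

lemma char_red_stable_large:
  assumes "\<mu> > 0" "\<tau> > 0" "B \<ge> 0" "\<gamma> > \<mu>" and root: "char_red \<mu> \<gamma> \<tau> B z = 0"
  shows "Re z < 0"
proof (rule ccontr)
  assume "\<not> Re z < 0"
  then have z: "Re z \<ge> 0"
    by simp
  have z0: "z \<noteq> 0"
  proof
    assume "z = 0"
    then have "complex_of_real (\<gamma> + \<mu> * B * \<tau>) = 0"
      using root assms unfolding char_red_def by (simp add: scaleR_conv_of_real)
    then have "\<gamma> + \<mu> * B * \<tau> = 0"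
      using of_real_eq_0_iff by blast
    moreover have "\<mu> * B * \<tau> \<ge> 0" "\<gamma> > 0"
      using assms by auto
    ultimately show False
      by linarith
  qed
  define w where "w = z + of_real \<mu>"
  have w: "Re w > 0"
    unfolding w_def using z assms by simp
  then have w0: "w \<noteq> 0"
    by auto
  have "z * (z + of_real \<gamma>) = - (of_real B * w * (1 - exp (- z * of_real \<tau>)))"
    using char_red_times[of \<tau> z \<mu> \<gamma> B] root assms(2) unfolding w_def
    by (simp add: eq_neg_iff_add_eq_0)
  then have "z * (z + of_real \<gamma>) * cnj w
      = - (of_real B * (w * cnj w) * (1 - exp (- z * of_real \<tau>)))"
    by (simp add: mult_ac)
  also have "w * cnj w = of_real ((norm w)\<^sup>2)"
    by (metis complex_norm_square)
  also have "Re (- (of_real B * of_real ((norm w)\<^sup>2) * (1 - exp (- z * of_real \<tau>))))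
      = - (B * (norm w)\<^sup>2 * Re (1 - exp (- z * of_real \<tau>)))"
    by (simp flip: of_real_mult)
  also have "\<dots> \<le> 0"
    using Re_one_minus_exp_nonneg[OF z, of \<tau>] assms by simp
  finally have "Re (z * (z + of_real \<gamma>) * cnj w) \<le> 0" .
  moreover have "z * (z + of_real \<gamma>) * cnj w = z * (w * cnj w) + of_real (\<gamma> - \<mu>) * (z * cnj w)"
    unfolding w_def by (simp add: algebra_simps)
  moreover have "z * (w * cnj w) = of_real ((norm w)\<^sup>2) * z"
    by (metis complex_norm_square mult.commute)
  moreover have "z * cnj w = of_real ((norm z)\<^sup>2) + of_real \<mu> * z"
    unfolding w_def by (simp add: complex_norm_square[symmetric] distrib_left mult.commute del: of_real_power)
  ultimately have "(norm w)\<^sup>2 * Re z + (\<gamma> - \<mu>) * ((norm z)\<^sup>2 + \<mu> * Re z) \<le> 0"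
    by simp
  moreover have "(\<gamma> - \<mu>) * ((norm z)\<^sup>2 + \<mu> * Re z) > 0"
    using assms z z0 by (intro mult_pos_pos add_pos_nonneg) auto
  moreover have "(norm w)\<^sup>2 * Re z \<ge> 0"
    using z by simp
  ultimately show False
    by linarith
qed

section \<open>Steady states\<close>

locale dde =
  fixes P :: dde_params
  assumes pos: "beta P > 0" "mu P > 0" "adel P > 0" "gpm P > 0" "vplus P > 0" "thetav P > 0"
    and decr: "vminus P > vplus P"
begin

definition ratio :: "real \<Rightarrow> real \<Rightarrow> real" where
  "ratio m x = (x / thetav P) powr m"

definition delay :: "real \<Rightarrow> real" where
  "delay y = adel P * (1 + y) / (vminus P + vplus P * y)"

text \<open>The elasticity of \<open>v\<close> is \<open>x v'(x) / v(x) = - m * sens ((x / \<theta>)\<^sup>m)\<close>.\<close>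

definition sens :: "real \<Rightarrow> real" where
  "sens y = y * (vminus P - vplus P) / ((1 + y) * (vminus P + vplus P * y))"

lemma vminus_pos: "vminus P > 0"
  using pos decr by linarith

lemma denom_pos: "y \<ge> 0 \<Longrightarrow> vminus P + vplus P * y > 0"
  using vminus_pos pos by (simp add: add_pos_nonneg)

lemma ratio_pos: "x > 0 \<Longrightarrow> ratio m x > 0"
  unfolding ratio_def using pos by simp

lemma vfun_eq:
  assumes "x > 0"
  shows "vfun P m x = (vminus P + vplus P * ratio m x) / (1 + ratio m x)"
proof -
  have "ratio m x = x powr m / thetav P powr m"
    unfolding ratio_def using assms pos by (simp add: powr_divide)
  moreover have "thetav P powr m > 0" "x powr m > 0"
    using assms pos by auto
  moreover have "(vm * T + vp * X) / (T + X) = (vm + vp * (X / T)) / (1 + X / T)"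
    if "T > 0" "X > 0" for vm vp T X :: real
  proof -
    have "vm + vp * (X / T) = (vm * T + vp * X) / T" "1 + X / T = (T + X) / T"
      using that by (simp_all add: field_simps)
    then show ?thesis
      using that by simp
  qed
  ultimately show ?thesis
    unfolding vfun_def hill_def by metis
qed

lemma tau_eq: "x > 0 \<Longrightarrow> tau P m x = delay (ratio m x)"
  using ratio_pos[of x m] unfolding tau_def delay_def by (simp add: vfun_eq)

lemma elasticity:
  assumes "x > 0"
  shows "x * deriv (vfun P m) x / vfun P m x = - m * sens (ratio m x)"
proof -
  define T X where "T = thetav P powr m" and "X = x powr m"
  have TX: "T > 0" "X > 0"
    unfolding T_def X_def using assms pos by auto
  have y: "ratio m x = X / T"
    unfolding ratio_def T_def X_def using assms pos by (simp add: powr_divide)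
  have den: "vminus P * T + vplus P * X > 0"
    using TX pos vminus_pos by (simp add: add_pos_pos)
  have dX: "((\<lambda>x. x powr m) has_real_derivative m * X / x) (at x)"
    unfolding X_def using assms by (auto intro!: derivative_eq_intros simp: powr_diff)
  have "(vfun P m has_real_derivative
      (vplus P * (m * X / x) * (T + X) - (vminus P * T + vplus P * X) * (m * X / x)) / ((T + X) * (T + X))) (at x)"
    unfolding vfun_def[abs_def] hill_def T_def[symmetric] X_def
    using DERIV_divide[OF DERIV_add[OF DERIV_const DERIV_cmult[OF dX]] DERIV_add[OF DERIV_const dX],
        of T "vminus P * T" "vplus P"] TX
    unfolding X_def by simp
  then have "deriv (vfun P m) x = (vplus P * (m * X / x) * (T + X) - (vminus P * T + vplus P * X) * (m * X / x)) / ((T + X) * (T + X))"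
    by (rule DERIV_imp_deriv)
  also have "\<dots> = - (m * X * T * (vminus P - vplus P)) / (x * ((T + X) * (T + X)))"
    using TX assms by (simp add: divide_simps) (simp add: algebra_simps)
  finally have d: "deriv (vfun P m) x = - (m * X * T * (vminus P - vplus P)) / (x * ((T + X) * (T + X)))" .
  have v: "vfun P m x = (vminus P * T + vplus P * X) / (T + X)"
    unfolding vfun_def hill_def T_def X_def ..
  have s: "sens (ratio m x) = X * T * (vminus P - vplus P) / ((T + X) * (vminus P * T + vplus P * X))"
  proof -
    have "1 + X / T = (T + X) / T" "vminus P + vplus P * (X / T) = (vminus P * T + vplus P * X) / T"
      using TX by (simp_all add: field_simps)
    then show ?thesis
      unfolding sens_def y using TX by simp
  qed
  show ?thesis
    unfolding d v s using TX assms den by (simp add: divide_simps)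
qed

lemma sens_pos: "y > 0 \<Longrightarrow> sens y > 0"
  unfolding sens_def using decr denom_pos[of y] by simp

lemma sens_le_ratio:
  assumes "y > 0"
  shows "sens y \<le> y"
proof -
  have "y * (vminus P - vplus P) \<le> y * ((1 + y) * (vminus P + vplus P * y))"
    using assms pos vminus_pos by (intro mult_left_mono) (auto simp: algebra_simps add_nonneg_nonneg)
  then show ?thesis
    unfolding sens_def using assms denom_pos[of y] by (simp add: divide_le_eq)
qed

lemma sens_le_inverse:
  assumes "y > 0"
  shows "sens y \<le> (vminus P - vplus P) / (vplus P * y)"
proof -
  have "(vminus P - vplus P) * (y * (vplus P * y)) \<le> (vminus P - vplus P) * ((1 + y) * (vminus P + vplus P * y))"
    using assms pos vminus_pos decr by (intro mult_left_mono mult_mono) auto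
  then show ?thesis
    unfolding sens_def using assms denom_pos[of y] pos by (simp add: frac_le_eq divide_simps mult_ac)
qed

lemma sens_less_1:
  assumes "y > 0"
  shows "sens y < 1"
proof -
  have "y * (vminus P - vplus P) < (1 + y) * (vminus P + vplus P * y)"
    using assms pos vminus_pos by (simp add: algebra_simps add_nonneg_pos add_pos_nonneg)
  then show ?thesis
    unfolding sens_def using assms denom_pos[of y] by (simp add: divide_less_eq)
qed

lemma sens_le_sqrt:
  assumes "y > 0"
  shows "sens y \<le> (sqrt (vminus P / vplus P) - 1) / (sqrt (vminus P / vplus P) + 1)"
proof -
  define s where "s = sqrt (vminus P / vplus P)"
  have s2: "vminus P = s * s * vplus P"
    unfolding s_def using pos vminus_pos by simp
  have s1: "s > 1"
    unfolding s_def using pos decr by simp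
  have "y * (s - 1) * (s + 1) * (s + 1) \<le> (s - 1) * ((1 + y) * (s * s + y))"
  proof -
    have "(s - 1) * ((1 + y) * (s * s + y)) - y * (s - 1) * (s + 1) * (s + 1) = (s - 1) * (y - s)\<^sup>2"
      by (simp add: power2_eq_square algebra_simps)
    moreover have "(s - 1) * (y - s)\<^sup>2 \<ge> 0"
      using s1 by simp
    ultimately show ?thesis
      by linarith
  qed
  then have "y * (s * s - 1) * (s + 1) \<le> (s - 1) * ((1 + y) * (s * s + y))"
    by (simp add: algebra_simps)
  moreover have "sens y = y * (s * s - 1) / ((1 + y) * (s * s + y))"
  proof -
    have "y * (vminus P - vplus P) = vplus P * (y * (s * s - 1))"
         "(1 + y) * (vminus P + vplus P * y) = vplus P * ((1 + y) * (s * s + y))"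
      unfolding s2 by (simp_all add: algebra_simps)
    then show ?thesis
      unfolding sens_def using pos(5) by (simp only: mult_divide_mult_cancel_left)
  qed
  moreover have "(1 + y) * (s * s + y) > 0"
    using assms s1 by (intro mult_pos_pos add_pos_pos) auto
  moreover have "N / D \<le> (s - 1) / (s + 1)" if "N * (s + 1) \<le> (s - 1) * D" "D > 0" for N D
    using that s1 by (simp add: pos_divide_le_eq pos_le_divide_eq)
  ultimately show ?thesis
    unfolding s_def[symmetric] by metis
qed

lemma delay_mono:
  assumes "0 \<le> y" "y < z"
  shows "delay y < delay z"
proof -
  have "adel P * ((1 + y) * (vminus P + vplus P * z)) < adel P * ((1 + z) * (vminus P + vplus P * y))"
  proof (rule mult_strict_left_mono)
    have "(z - y) * (vminus P - vplus P) > 0"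
      using assms decr by simp
    then show "(1 + y) * (vminus P + vplus P * z) < (1 + z) * (vminus P + vplus P * y)"
      by (simp add: algebra_simps)
  qed (rule pos)
  then show ?thesis
    unfolding delay_def using denom_pos[of y] denom_pos[of z] assms by (simp add: divide_simps mult_ac)
qed

lemma delay_bounds:
  assumes "y > 0"
  shows "adel P / vminus P < delay y" "delay y < adel P / vplus P"
proof -
  show "adel P / vminus P < delay y"
    using delay_mono[of 0 y] assms unfolding delay_def by simp
  have "adel P * (vplus P + vplus P * y) < adel P * (vminus P + vplus P * y)"
    using decr pos by (intro mult_strict_left_mono) auto
  then show "delay y < adel P / vplus P"
    unfolding delay_def using denom_pos[of y] assms pos by (simp add: divide_simps algebra_simps)
qed

lemma delay_pos: "y > 0 \<Longrightarrow> delay y > 0"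
  unfolding delay_def using pos denom_pos[of y] by simp

lemma gamma_of_eq:
  "x > 0 \<Longrightarrow> gamma_of P m x = beta P * gpm P * exp (- mu P * delay (ratio m x)) / x"
  unfolding gamma_of_def by (simp add: tau_eq)

lemma gamma_of_pos: "x > 0 \<Longrightarrow> gamma_of P m x > 0"
  unfolding gamma_of_def using pos by simp

lemma is_steady_iff: "is_steady P m gam x \<longleftrightarrow> x > 0 \<and> gam = gamma_of P m x"
  unfolding is_steady_def gamma_of_def by (auto simp: field_simps)

lemma gamma_of_bounds:
  assumes "x > 0"
  shows "gamma3 P * thetav P < gamma_of P m x * x" "gamma_of P m x * x < gamma4 P * thetav P"
proof -
  have "exp (- mu P * (adel P / vplus P)) < exp (- mu P * delay (ratio m x))"
       "exp (- mu P * delay (ratio m x)) < exp (- mu P * (adel P / vminus P))"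
    using mult_strict_left_mono[OF delay_bounds(1)[OF ratio_pos[OF assms, of m]] pos(2)]
      mult_strict_left_mono[OF delay_bounds(2)[OF ratio_pos[OF assms, of m]] pos(2)] by auto
  then show "gamma3 P * thetav P < gamma_of P m x * x" "gamma_of P m x * x < gamma4 P * thetav P"
    unfolding gamma_of_eq[OF assms] gamma3_def gamma4_def using pos assms by auto
qed

lemma gamma_of_strict_antimono:
  assumes "m > 0" "0 < x" "x < x'"
  shows "gamma_of P m x' < gamma_of P m x"
proof -
  have "ratio m x < ratio m x'"
    unfolding ratio_def using assms pos by (intro powr_less_mono2) (auto simp: divide_strict_right_mono)
  then have "delay (ratio m x) < delay (ratio m x')"
    using ratio_pos[of x m] assms by (intro delay_mono) auto
  then have "beta P * gpm P * exp (- mu P * delay (ratio m x')) < beta P * gpm P * exp (- mu P * delay (ratio m x))"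
    using pos by simp
  then show ?thesis
    using assms pos unfolding gamma_of_eq[OF assms(2)] gamma_of_eq[OF order_less_trans[OF assms(2,3)]]
    by (intro frac_less) auto
qed

lemma steady_gamma_of:
  assumes "m > 0" "x > 0"
  shows "steady P m (gamma_of P m x) = x"
  unfolding steady_def
proof (rule the_equality)
  show "is_steady P m (gamma_of P m x) x"
    using assms by (simp add: is_steady_iff)
  fix x'
  assume "is_steady P m (gamma_of P m x) x'"
  then show "x' = x"
    using gamma_of_strict_antimono[OF assms(1), of x x'] gamma_of_strict_antimono[OF assms(1), of x' x] assms(2)
    unfolding is_steady_iff by (cases x x' rule: linorder_cases) auto
qed

lemma coefA_eq:
  assumes "x > 0"
  shows "coefA P m x = - (gamma_of P m x * m * sens (ratio m x))"
proof -
  have "coefA P m x = gamma_of P m x * (x * deriv (vfun P m) x / vfun P m x)"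
    unfolding coefA_def gamma_of_def using assms by simp
  then show ?thesis
    unfolding elasticity[OF assms] by simp
qed

lemma charfun_eq:
  assumes "x > 0"
  shows "charfun P m (gamma_of P m x) x = char_red (mu P) (gamma_of P m x) (delay (ratio m x))
     (gamma_of P m x * m * sens (ratio m x))"
  unfolding charfun_def char_red_def Let_def tau_eq[OF assms] coefA_eq[OF assms]
  by (simp add: fun_eq_iff algebra_simps)

section \<open>Stability of the steady state\<close>

lemma asym_stableI:
  assumes "m > 0" "x > 0" "m * sens (ratio m x) * (mu P * delay (ratio m x)) < 1"
  shows "asym_stable P m (gamma_of P m x) x"
proof -
  have "gamma_of P m x * (m * sens (ratio m x) * (mu P * delay (ratio m x))) < gamma_of P m x * 1"
    using assms gamma_of_pos[OF assms(2)] by (intro mult_strict_left_mono) auto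
  then have *: "gamma_of P m x * m * sens (ratio m x) * mu P * delay (ratio m x) < gamma_of P m x"
    by (simp add: mult_ac)
  show ?thesis
    unfolding asym_stable_def charfun_eq[OF assms(2)]
  proof (intro allI impI)
    fix z
    assume "char_red (mu P) (gamma_of P m x) (delay (ratio m x)) (gamma_of P m x * m * sens (ratio m x)) z = 0"
    then show "Re z < 0"
      by (rule char_red_stable_small[rotated 4])
        (use * assms pos delay_pos[OF ratio_pos[OF assms(2)]] sens_pos[OF ratio_pos[OF assms(2)], of m]
          gamma_of_pos[OF assms(2), of m] in \<open>auto intro!: mult_nonneg_nonneg\<close>)
  qed
qed

lemma stable_of_elasticity:
  assumes "m > 0" "is_steady P m gam x"
    "\<bar>x * deriv (vfun P m) x / vfun P m x\<bar> < 1 / (mu P * tau P m x)"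
  shows "asym_stable P m gam x"
proof -
  have x: "x > 0" "gam = gamma_of P m x"
    using assms(2) by (auto simp: is_steady_iff)
  have d: "mu P * delay (ratio m x) > 0"
    using pos delay_pos[OF ratio_pos[OF x(1)]] by simp
  have "m * sens (ratio m x) < 1 / (mu P * delay (ratio m x))"
    using assms(1,3) sens_pos[OF ratio_pos[OF x(1)], of m] unfolding elasticity[OF x(1)] tau_eq[OF x(1)]
    by (simp add: abs_mult)
  then show ?thesis
    unfolding x(2) using asym_stableI[OF assms(1) x(1)] d by (simp add: pos_less_divide_eq)
qed

lemma stable_of_hill_exponent:
  assumes m: "m > 0" and st: "is_steady P m gam x"
    and le: "m \<le> 1 / (mu P * tau P m x) \<or>
      (m > 1 / (mu P * tau P m x) \<and> vminus P / vplus P < (1 + 2 / (m * mu P * tau P m x - 1))\<^sup>2)"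
  shows "asym_stable P m gam x"
proof -
  have x: "x > 0" "gam = gamma_of P m x"
    using st by (auto simp: is_steady_iff)
  define y d where "y = ratio m x" and "d = mu P * delay y"
  have y: "y > 0"
    unfolding y_def using x(1) by (rule ratio_pos)
  have d: "d > 0"
    unfolding d_def using pos delay_pos[OF y] by simp
  have tau: "mu P * tau P m x = d" "m * mu P * tau P m x = m * d"
    unfolding d_def y_def tau_eq[OF x(1)] by simp_all
  have "m * sens y * d < 1"
    using le
  proof
    assume "m \<le> 1 / (mu P * tau P m x)"
    then have "m * d \<le> 1"
      unfolding tau using d by (simp add: pos_le_divide_eq)
    moreover have "sens y * (m * d) < 1 * (m * d)"
      using sens_less_1[OF y] m d by (intro mult_strict_right_mono) auto
    ultimately show ?thesis
      by (simp add: mult_ac)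
  next
    define s where "s = sqrt (vminus P / vplus P)"
    have s1: "s > 1"
      unfolding s_def using pos decr by simp
    assume "m > 1 / (mu P * tau P m x) \<and> vminus P / vplus P < (1 + 2 / (m * mu P * tau P m x - 1))\<^sup>2"
    then have md: "m * d > 1" and r: "vminus P / vplus P < (1 + 2 / (m * d - 1))\<^sup>2"
      unfolding tau using d by (simp_all add: pos_divide_less_eq)
    have "s < sqrt ((1 + 2 / (m * d - 1))\<^sup>2)"
      unfolding s_def using r by (rule real_sqrt_less_mono)
    also have "\<dots> = 1 + 2 / (m * d - 1)"
      using md by simp
    also have "\<dots> = (m * d + 1) / (m * d - 1)"
      using md by (simp add: field_simps)
    finally have "s * (m * d - 1) < m * d + 1"
      using md by (simp add: pos_less_divide_eq)
    then have "(s - 1) * (m * d) < s + 1"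
      by (simp add: algebra_simps)
    then have "(s - 1) / (s + 1) * (m * d) < 1"
      using s1 by (simp add: pos_divide_less_eq)
    moreover have "sens y * (m * d) \<le> (s - 1) / (s + 1) * (m * d)"
      using sens_le_sqrt[OF y] m d unfolding s_def by (intro mult_right_mono) auto
    ultimately show ?thesis
      by (simp add: mult_ac)
  qed
  then show ?thesis
    unfolding x(2) d_def y_def by (rule asym_stableI[OF m x(1)])
qed

lemma stable_of_large_gamma:
  assumes "m > 0" "gam > mu P" "is_steady P m gam x"
  shows "asym_stable P m gam x"
proof -
  have x: "x > 0" "gam = gamma_of P m x"
    using assms by (auto simp: is_steady_iff)
  show ?thesis
    unfolding asym_stable_def x(2) charfun_eq[OF x(1)]
    using char_red_stable_large[of "mu P" "delay (ratio m x)" "gamma_of P m x * m * sens (ratio m x)" "gamma_of P m x"]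
      assms pos delay_pos[OF ratio_pos[OF x(1)]] sens_pos[OF ratio_pos[OF x(1)], of m] gamma_of_pos[OF x(1), of m]
    unfolding x(2) by auto
qed

definition maxdelay :: real where
  "maxdelay = mu P * (adel P / vplus P)"

lemma maxdelay_pos: "maxdelay > 0"
  unfolding maxdelay_def using pos by simp

lemma delay_less_maxdelay: "y > 0 \<Longrightarrow> mu P * delay y < maxdelay"
  unfolding maxdelay_def by (rule mult_strict_left_mono[OF delay_bounds(2) pos(2)])

lemma stable_of_sens_bound:
  assumes "m > 0" "x > 0" "sens (ratio m x) \<le> s" "m * s * maxdelay \<le> 1"
  shows "asym_stable P m (gamma_of P m x) x"
proof (rule asym_stableI[OF assms(1,2)])
  have y: "ratio m x > 0"
    using assms(2) by (rule ratio_pos)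
  have "m * sens (ratio m x) * (mu P * delay (ratio m x)) < m * sens (ratio m x) * maxdelay"
    using delay_less_maxdelay[OF y] sens_pos[OF y] assms(1) by simp
  also have "\<dots> \<le> m * s * maxdelay"
    using assms maxdelay_pos by simp
  finally show "m * sens (ratio m x) * (mu P * delay (ratio m x)) < 1"
    using assms(4) by linarith
qed

lemma stable_of_small_ratio:
  assumes "m > 0" "x > 0" "m * ratio m x * maxdelay \<le> 1"
  shows "asym_stable P m (gamma_of P m x) x"
  using stable_of_sens_bound[OF assms(1,2) sens_le_ratio[OF ratio_pos[OF assms(2)]] assms(3)] .

lemma stable_of_large_ratio:
  assumes "m > 0" "x > 0" "m * maxdelay * (vminus P / vplus P) \<le> ratio m x"
  shows "asym_stable P m (gamma_of P m x) x"
proof (rule stable_of_sens_bound[OF assms(1,2) sens_le_inverse[OF ratio_pos[OF assms(2)]]])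
  have y: "ratio m x > 0"
    using assms(2) by (rule ratio_pos)
  have "m * maxdelay * (vminus P - vplus P) \<le> m * maxdelay * vminus P"
    using assms(1) maxdelay_pos pos by (intro mult_left_mono) auto
  also have "\<dots> \<le> ratio m x * vplus P"
    using assms(3) pos by (simp add: pos_divide_le_eq)
  finally show "m * ((vminus P - vplus P) / (vplus P * ratio m x)) * maxdelay \<le> 1"
    using y pos by (simp add: divide_simps mult_ac)
qed

lemma stable_extreme_states:
  assumes "m > 0"
  obtains \<delta> K where "\<delta> > 0" "K > 0" "\<And>x. 0 < x \<Longrightarrow> x < \<delta> \<or> x > K \<Longrightarrow> asym_stable P m (gamma_of P m x) x"
proof -
  have powr_root: "(c powr (1 / m)) powr m = c" if "c > 0" for c
    using that assms by (simp add: powr_powr)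
  define c C where "c = 1 / (m * maxdelay)" and "C = m * maxdelay * (vminus P / vplus P)"
  have cC: "c > 0" "C > 0"
    unfolding c_def C_def using assms maxdelay_pos pos vminus_pos by auto
  show ?thesis
  proof
    show "thetav P * c powr (1 / m) > 0" "thetav P * C powr (1 / m) > 0"
      using pos cC by auto
    fix x :: real
    assume x: "0 < x"
    assume "x < thetav P * c powr (1 / m) \<or> x > thetav P * C powr (1 / m)"
    then show "asym_stable P m (gamma_of P m x) x"
    proof
      assume "x < thetav P * c powr (1 / m)"
      then have "x / thetav P < c powr (1 / m)"
        using pos by (simp add: pos_divide_less_eq mult.commute)
      then have "ratio m x < (c powr (1 / m)) powr m"
        unfolding ratio_def using assms x pos by (intro powr_less_mono2) auto
      then have "ratio m x < c"
        unfolding powr_root[OF cC(1)] .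
      then have "m * ratio m x * maxdelay \<le> 1"
        unfolding c_def using assms maxdelay_pos by (simp add: field_simps)
      then show ?thesis
        by (rule stable_of_small_ratio[OF assms x])
    next
      assume "x > thetav P * C powr (1 / m)"
      then have "x / thetav P > C powr (1 / m)"
        using pos by (simp add: pos_less_divide_eq mult.commute)
      then have "ratio m x > (C powr (1 / m)) powr m"
        unfolding ratio_def using assms x pos by (intro powr_less_mono2) auto
      then have "ratio m x > C"
        unfolding powr_root[OF cC(2)] .
      then show ?thesis
        unfolding C_def by (intro stable_of_large_ratio[OF assms x]) simp
    qed
  qed
qed

lemma gamma3_pos: "gamma3 P > 0" and gamma4_pos: "gamma4 P > 0"
  unfolding gamma3_def gamma4_def using pos by auto

lemma stable_extreme_gamma:
  assumes "m > 0"
  shows "\<exists>G1 G2. G2 > 0 \<and> (\<forall>gam x. (gam > G1 \<or> (0 < gam \<and> gam < G2)) \<and> is_steady P m gam x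
            \<longrightarrow> asym_stable P m gam x)"
proof -
  obtain \<delta> K where dK: "\<delta> > 0" "K > 0" "\<And>x. 0 < x \<Longrightarrow> x < \<delta> \<or> x > K \<Longrightarrow> asym_stable P m (gamma_of P m x) x"
    using stable_extreme_states[OF assms] by metis
  define G1 G2 where "G1 = gamma4 P * thetav P / \<delta>" and "G2 = gamma3 P * thetav P / K"
  have "asym_stable P m gam x" if g: "gam > G1 \<or> (0 < gam \<and> gam < G2)" and st: "is_steady P m gam x" for gam x
  proof -
    have x: "x > 0" "gam = gamma_of P m x"
      using st by (auto simp: is_steady_iff)
    note b = gamma_of_bounds[OF x(1), of m, folded x(2)]
    have "x < \<delta> \<or> x > K"
      using g
    proof
      assume "gam > G1"
      then have "gamma4 P * thetav P < gam * \<delta>"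
        unfolding G1_def using dK by (simp add: pos_divide_less_eq)
      then have "gam * x < gam * \<delta>"
        using b by linarith
      then show ?thesis
        using gamma_of_pos[OF x(1), of m] x(2) by simp
    next
      assume "0 < gam \<and> gam < G2"
      then have "gam * K < gamma3 P * thetav P"
        unfolding G2_def using dK by (simp add: pos_less_divide_eq)
      then have "gam * K < gam * x"
        using b by linarith
      then show ?thesis
        using gamma_of_pos[OF x(1), of m] x(2) by simp
    qed
    then show ?thesis
      unfolding x(2) using dK(3) x(1) by blast
  qed
  moreover have "G2 > 0"
    unfolding G2_def using gamma3_pos pos dK by simp
  ultimately show ?thesis
    by blast
qed

lemma stable_large_exponent_small_state:
  assumes "0 < q" "q < 1"
  obtains M where "M > 0" "\<And>m x. m \<ge> M \<Longrightarrow> 0 < x \<Longrightarrow> x \<le> thetav P * q \<Longrightarrow> asym_stable P m (gamma_of P m x) x"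
proof -
  have "((\<lambda>m. m * q powr m * maxdelay) \<longlongrightarrow> 0) at_top"
    using assms by real_asymp
  then have "\<forall>\<^sub>F m in at_top. m * q powr m * maxdelay < 1"
    by (rule order_tendstoD) simp
  then obtain M0 where M0: "\<And>m. m \<ge> M0 \<Longrightarrow> m * q powr m * maxdelay < 1"
    unfolding eventually_at_top_linorder by blast
  show ?thesis
  proof
    show "max M0 1 > 0"
      by simp
    fix m x
    assume m: "m \<ge> max M0 1" and x: "0 < x" "x \<le> thetav P * q"
    have "ratio m x \<le> q powr m"
      unfolding ratio_def using m x pos by (intro powr_mono2) (auto simp: pos_divide_le_eq mult.commute)
    then have "m * ratio m x * maxdelay \<le> m * q powr m * maxdelay"
      using m maxdelay_pos by (intro mult_left_mono mult_right_mono) auto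
    also have "\<dots> < 1"
      using M0[of m] m by simp
    finally have "m * ratio m x * maxdelay \<le> 1"
      by simp
    then show "asym_stable P m (gamma_of P m x) x"
      using m x by (intro stable_of_small_ratio) auto
  qed
qed

lemma stable_large_exponent_large_state:
  assumes "q > 1"
  obtains M where "M > 0" "\<And>m x. m \<ge> M \<Longrightarrow> x \<ge> thetav P * q \<Longrightarrow> asym_stable P m (gamma_of P m x) x"
proof -
  define C where "C = maxdelay * (vminus P / vplus P)"
  have "((\<lambda>m. m * C / q powr m) \<longlongrightarrow> 0) at_top"
    using assms by real_asymp
  then have "\<forall>\<^sub>F m in at_top. m * C / q powr m < 1"
    by (rule order_tendstoD) simp
  then obtain M0 where M0: "\<And>m. m \<ge> M0 \<Longrightarrow> m * C / q powr m < 1"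
    unfolding eventually_at_top_linorder by blast
  show ?thesis
  proof
    show "max M0 1 > 0"
      by simp
    fix m x
    assume m: "m \<ge> max M0 1" and x: "x \<ge> thetav P * q"
    have x0: "x > 0"
      using x assms pos by (smt (verit) mult_pos_pos)
    have "q powr m \<le> ratio m x"
      unfolding ratio_def using m x assms pos by (intro powr_mono2) (auto simp: pos_le_divide_eq mult.commute)
    moreover have "m * C < q powr m"
      using M0[of m] m assms by (simp add: pos_divide_less_eq)
    ultimately show "asym_stable P m (gamma_of P m x) x"
      using m x0 unfolding C_def by (intro stable_of_large_ratio) (auto simp: mult_ac)
  qed
qed

lemma stable_large_exponent_fixed_state:
  assumes "0 < x" "x \<noteq> thetav P"
  shows "\<exists>M>0. \<forall>m\<ge>M. asym_stable P m (gamma_of P m x) x"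
proof (cases "x < thetav P")
  case True
  show ?thesis
    by (rule stable_large_exponent_small_state[of "x / thetav P"])
      (use assms True pos in \<open>auto simp: divide_simps\<close>)
next
  case False
  show ?thesis
    by (rule stable_large_exponent_large_state[of "x / thetav P"])
      (use assms False pos in \<open>auto simp: divide_simps\<close>)
qed

lemma stable_large_exponent_fixed_gamma:
  assumes "(0 < gam \<and> gam < gamma3 P) \<or> gam > gamma4 P"
  shows "\<exists>M>0. \<forall>m\<ge>M. \<forall>x. is_steady P m gam x \<longrightarrow> asym_stable P m gam x"
  using assms
proof
  assume g: "gam > gamma4 P"
  then have g0: "gam > 0"
    using gamma4_pos by linarith
  obtain M where M: "M > 0" "\<And>m x. m \<ge> M \<Longrightarrow> 0 < x \<Longrightarrow> x \<le> thetav P * (gamma4 P / gam)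
      \<Longrightarrow> asym_stable P m (gamma_of P m x) x"
    by (rule stable_large_exponent_small_state[of "gamma4 P / gam"]) (use g g0 gamma4_pos in auto)
  have "asym_stable P m gam x" if "m \<ge> M" "is_steady P m gam x" for m x
  proof -
    have x: "x > 0" "gam = gamma_of P m x"
      using that by (auto simp: is_steady_iff)
    have "x \<le> thetav P * (gamma4 P / gam)"
      using gamma_of_bounds(2)[OF x(1), of m, folded x(2)] g0 by (simp add: field_simps)
    then show ?thesis
      using M(2)[OF that(1) x(1)] x(2) by simp
  qed
  then show ?thesis
    using M(1) by blast
next
  assume g: "0 < gam \<and> gam < gamma3 P"
  obtain M where M: "M > 0" "\<And>m x. m \<ge> M \<Longrightarrow> x \<ge> thetav P * (gamma3 P / gam)
      \<Longrightarrow> asym_stable P m (gamma_of P m x) x"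
    by (rule stable_large_exponent_large_state[of "gamma3 P / gam"]) (use g in auto)
  have "asym_stable P m gam x" if "m \<ge> M" "is_steady P m gam x" for m x
  proof -
    have x: "x > 0" "gam = gamma_of P m x"
      using that by (auto simp: is_steady_iff)
    have "x \<ge> thetav P * (gamma3 P / gam)"
      using gamma_of_bounds(1)[OF x(1), of m, folded x(2)] g by (simp add: field_simps)
    then show ?thesis
      using M(2)[OF that(1)] x(2) by simp
  qed
  then show ?thesis
    using M(1) by blast
qed

section \<open>Hopf bifurcations in the decay rate\<close>

abbreviation "state u \<equiv> thetav P * exp u"

lemma state_pos: "state u > 0"
  using pos by simp

lemma ratio_state: "ratio m (state u) = exp (m * u)"
  unfolding ratio_def using pos by (simp add: powr_def)

lemma gamma_of_state: "gamma_of P m (state u) = beta P * gpm P * exp (- mu P * delay (exp (m * u))) / state u"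
  using gamma_of_eq[OF state_pos] unfolding ratio_state .

definition freq_delay :: "real \<Rightarrow> real \<Rightarrow> real" where
  "freq_delay m u = freq_sq (mu P) (gamma_of P m (state u))
     (gamma_of P m (state u) * m * sens (exp (m * u))) * (delay (exp (m * u)))\<^sup>2"

lemma real_analytic_on_delay [real_analytic_intros]:
  assumes "f real_analytic_on S" "\<And>x. x \<in> S \<Longrightarrow> f x > 0"
  shows "(\<lambda>x. delay (f x)) real_analytic_on S"
  unfolding delay_def
proof (intro real_analytic_intros assms(1))
  fix x
  assume "x \<in> S"
  then show "vminus P + vplus P * f x \<noteq> 0"
    using denom_pos[of "f x"] assms(2)[of x] by simp
qed

lemma real_analytic_on_sens [real_analytic_intros]:
  assumes "f real_analytic_on S" "\<And>x. x \<in> S \<Longrightarrow> f x > 0"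
  shows "(\<lambda>x. sens (f x)) real_analytic_on S"
  unfolding sens_def
proof (intro real_analytic_intros assms(1))
  fix x
  assume "x \<in> S"
  then show "(1 + f x) * (vminus P + vplus P * f x) \<noteq> 0"
    using denom_pos[of "f x"] assms(2)[of x] by simp
qed

lemma real_analytic_on_gamma_of_state:
  assumes "f real_analytic_on S"
  shows "(\<lambda>x. gamma_of P m (state (f x))) real_analytic_on S"
  unfolding gamma_of_state by (intro real_analytic_intros assms) (use pos in auto)

lemma crossing_in_state:
  assumes "m > 0" "a < b" "freq_delay m (\<sigma> * a) < pi\<^sup>2" "freq_delay m (\<sigma> * b) > (2 * (real j + 1) * pi)\<^sup>2"
  obtains t0 \<omega> where "a < t0" "t0 < b"
    "crosses_lr (\<lambda>t. charfun P m (gamma_of P m (state (\<sigma> * t))) (state (\<sigma> * t))) t0 \<omega>"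
    "\<omega> * tau P m (state (\<sigma> * t0)) \<in> {(2 * real j + 1) * pi<..<(2 * real j + 2) * pi}"
proof -
  have an: "(\<lambda>t. gamma_of P m (state (\<sigma> * t))) real_analytic_on {a..b}"
    by (intro real_analytic_on_gamma_of_state real_analytic_intros)
  show ?thesis
  proof (rule analytic_crossing[OF pos(2) assms(2) an,
        of "\<lambda>t. delay (exp (m * (\<sigma> * t)))" "\<lambda>t. gamma_of P m (state (\<sigma> * t)) * m * sens (exp (m * (\<sigma> * t)))" j])
    show "(\<lambda>t. gamma_of P m (state (\<sigma> * t)) * m * sens (exp (m * (\<sigma> * t)))) real_analytic_on {a..b}"
      using an by (intro real_analytic_intros) auto
    show "(\<lambda>t. delay (exp (m * (\<sigma> * t)))) real_analytic_on {a..b}"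
      by (intro real_analytic_intros) auto
    show "gamma_of P m (state (\<sigma> * t)) > 0" for t
      by (rule gamma_of_pos[OF state_pos])
    then show "gamma_of P m (state (\<sigma> * t)) * m * sens (exp (m * (\<sigma> * t))) > 0" for t
      using assms(1) sens_pos by (intro mult_pos_pos) auto
  qed (use assms(3,4) that delay_pos in
      \<open>simp_all add: freq_delay_def charfun_eq[OF state_pos] tau_eq[OF state_pos] ratio_state\<close>)
qed

lemma steady_gamma_of_state: "m > 0 \<Longrightarrow> steady P m (gamma_of P m (state u)) = state u"
  by (rule steady_gamma_of[OF _ state_pos])

lemma continuous_on_gamma_of_state: "continuous_on S (\<lambda>t. gamma_of P m (state (\<sigma> * t)))"
  by (intro real_analytic_on_imp_continuous_on real_analytic_on_gamma_of_state real_analytic_intros)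

lemma hopf_rl_in_gamma:
  assumes "m > 0" "a < b" "freq_delay m a < pi\<^sup>2" "freq_delay m b > (2 * (real j + 1) * pi)\<^sup>2"
  shows "\<exists>gam0>0. \<exists>\<omega>. crosses_rl (\<lambda>gam z. charfun P m gam (steady P m gam) z) gam0 \<omega> \<and>
            \<omega> * tau P m (steady P m gam0) \<in> {(2 * real j + 1) * pi<..<(2 * real j + 2) * pi}"
proof -
  obtain t0 \<omega> where t0: "a < t0" "t0 < b"
    "crosses_lr (\<lambda>t. charfun P m (gamma_of P m (state (1 * t))) (state (1 * t))) t0 \<omega>"
    "\<omega> * tau P m (state (1 * t0)) \<in> {(2 * real j + 1) * pi<..<(2 * real j + 2) * pi}"
    by (rule crossing_in_state[of m a b 1 j]) (use assms in auto)
  have "crosses_rl (\<lambda>gam z. charfun P m gam (steady P m gam) z) (gamma_of P m (state (1 * t0))) \<omega>"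
  proof (rule crosses_rl_reparam[OF t0(3,1,2), where r = "\<lambda>p. ln (steady P m p / thetav P)"])
    show "continuous_on {a..b} (\<lambda>t. gamma_of P m (state (1 * t)))"
      by (rule continuous_on_gamma_of_state)
    show "gamma_of P m (state (1 * t)) < gamma_of P m (state (1 * s))" if "s < t" for s t
      using that pos state_pos by (intro gamma_of_strict_antimono[OF assms(1)]) auto
  qed (use pos steady_gamma_of_state[OF assms(1)] in auto)
  then show ?thesis
    using t0(4) gamma_of_pos[OF state_pos] steady_gamma_of_state[OF assms(1)] by metis
qed

lemma hopf_lr_in_gamma:
  assumes "m > 0" "a > b" "freq_delay m a < pi\<^sup>2" "freq_delay m b > (2 * (real j + 1) * pi)\<^sup>2"
  shows "\<exists>gam0>0. \<exists>\<omega>. crosses_lr (\<lambda>gam z. charfun P m gam (steady P m gam) z) gam0 \<omega> \<and>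
            \<omega> * tau P m (steady P m gam0) \<in> {(2 * real j + 1) * pi<..<(2 * real j + 2) * pi}"
proof -
  obtain t0 \<omega> where t0: "- a < t0" "t0 < - b"
    "crosses_lr (\<lambda>t. charfun P m (gamma_of P m (state (-1 * t))) (state (-1 * t))) t0 \<omega>"
    "\<omega> * tau P m (state (-1 * t0)) \<in> {(2 * real j + 1) * pi<..<(2 * real j + 2) * pi}"
    by (rule crossing_in_state[of m "- a" "- b" "- 1" j]) (use assms in auto)
  have "crosses_lr (\<lambda>gam z. charfun P m gam (steady P m gam) z) (gamma_of P m (state (-1 * t0))) \<omega>"
  proof (rule crosses_lr_reparam[OF t0(3,1,2), where r = "\<lambda>p. - ln (steady P m p / thetav P)"])
    show "continuous_on {- a..- b} (\<lambda>t. gamma_of P m (state (-1 * t)))"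
      by (rule continuous_on_gamma_of_state)
    show "gamma_of P m (state (-1 * s)) < gamma_of P m (state (-1 * t))" if "s < t" for s t
      using that pos state_pos by (intro gamma_of_strict_antimono[OF assms(1)]) auto
  qed (use pos steady_gamma_of_state[OF assms(1)] in auto)
  then show ?thesis
    using t0(4) gamma_of_pos[OF state_pos] steady_gamma_of_state[OF assms(1)] by metis
qed

lemma gamma_of_state_bounds:
  "gamma3 P * exp (- u) < gamma_of P m (state u)" "gamma_of P m (state u) < gamma4 P * exp (- u)"
proof -
  have "gamma3 P * exp (- u) * state u < gamma_of P m (state u) * state u"
    "gamma_of P m (state u) * state u < gamma4 P * exp (- u) * state u"
    using gamma_of_bounds[OF state_pos[of u], of m] by (simp_all add: exp_minus field_simps)
  then show "gamma3 P * exp (- u) < gamma_of P m (state u)" "gamma_of P m (state u) < gamma4 P * exp (- u)"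
    using state_pos[of u] by (auto simp only: mult_less_cancel_right_pos)
qed

lemma freq_delay_small_state:
  assumes "m > 0" "u \<le> ln (gamma3 P / mu P)"
  shows "freq_delay m u < pi\<^sup>2"
proof -
  define g where "g = gamma_of P m (state u)"
  have "exp u \<le> gamma3 P / mu P"
    using assms(2) gamma3_pos pos by (metis divide_pos_pos ln_ge_iff)
  then have "mu P \<le> gamma3 P * exp (- u)"
    using pos by (simp add: exp_minus field_simps)
  then have g: "mu P < g"
    unfolding g_def using gamma_of_state_bounds(1)[of u m] by linarith
  have "g * m * sens (exp (m * u)) \<ge> 0"
    using g pos assms(1) sens_pos[of "exp (m * u)"] by simp
  then have "2 * (g * m * sens (exp (m * u))) * (mu P - g) \<le> 0"
    using g by (intro mult_nonneg_nonpos) auto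
  then have "freq_sq (mu P) g (g * m * sens (exp (m * u))) \<le> 0"
    unfolding freq_sq_def by (smt (verit) zero_le_power2)
  then have "freq_delay m u \<le> 0"
    unfolding freq_delay_def g_def[symmetric] by (intro mult_nonpos_nonneg) auto
  then show ?thesis
    using pi_gt_zero by (smt (verit) zero_less_power)
qed

lemma freq_delay_large_state:
  assumes "m > 0"
  obtains u where "u > u0" "freq_delay m u < pi\<^sup>2"
proof -
  define D where "D = adel P / vplus P"
  have D: "D > 0"
    unfolding D_def using pos by simp
  define C where "C = 2 * (gamma4 P * m) * mu P * D\<^sup>2"
  have "((\<lambda>u. C * exp (- u)) \<longlongrightarrow> 0) at_top"
    by real_asymp
  then have "\<forall>\<^sub>F u in at_top. C * exp (- u) < pi\<^sup>2"
    by (rule order_tendstoD) simp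
  then obtain u where u: "u > u0" "C * exp (- u) < pi\<^sup>2"
    using eventually_conj[OF eventually_gt_at_top[of u0]] eventually_happens'[OF trivial_limit_at_top_linorder] by force
  define g s d where "g = gamma_of P m (state u)" and "s = sens (exp (m * u))" and "d = delay (exp (m * u))"
  have g: "0 < g" "g < gamma4 P * exp (- u)"
    unfolding g_def using gamma_of_pos[OF state_pos] gamma_of_state_bounds(2) by auto
  have s: "0 < s" "s < 1" and d: "0 < d" "d < D"
    unfolding s_def d_def D_def using sens_pos sens_less_1 delay_pos delay_bounds(2) by auto
  have "g * m * s \<le> (gamma4 P * exp (- u)) * m * 1"
    using g s assms by (intro mult_mono) auto
  then have "g * m * s * mu P \<le> gamma4 P * exp (- u) * m * mu P"
    using pos by (intro mult_right_mono) auto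
  moreover have "g * m * s * (mu P - g) \<le> g * m * s * mu P"
    using g s assms by (intro mult_left_mono) auto
  ultimately have "2 * (g * m * s) * (mu P - g) \<le> 2 * (gamma4 P * exp (- u) * m) * mu P"
    by simp
  then have "freq_sq (mu P) g (g * m * s) \<le> 2 * (gamma4 P * exp (- u) * m) * mu P"
    unfolding freq_sq_def by (smt (verit) zero_le_power2)
  then have "freq_delay m u \<le> 2 * (gamma4 P * exp (- u) * m) * mu P * d\<^sup>2"
    unfolding freq_delay_def g_def s_def d_def by (intro mult_right_mono) auto
  also have "\<dots> \<le> 2 * (gamma4 P * exp (- u) * m) * mu P * D\<^sup>2"
    using d assms pos gamma4_pos by (intro mult_left_mono power_mono) auto
  also have "\<dots> = C * exp (- u)"
    unfolding C_def by simp
  finally show ?thesis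
    using that[of u] u by linarith
qed

lemma freq_delay_transition_layer:
  assumes "mu P > gamma3 P"
  obtains Y M where "Y \<ge> 1" "M \<ge> 1" "\<And>m. m \<ge> M \<Longrightarrow> freq_delay m (ln Y / m) > N"
proof -
  define c where "c = beta P * gpm P / thetav P"
  have c: "c > 0"
    unfolding c_def using pos by simp
  have "(delay \<longlongrightarrow> adel P / vplus P) at_top"
    unfolding delay_def[abs_def] divide_inverse[of _ "vplus P"] using pos vminus_pos by real_asymp
  then have "((\<lambda>y. c * exp (- mu P * delay y)) \<longlongrightarrow> c * exp (- mu P * (adel P / vplus P))) at_top"
    by (intro tendsto_intros)
  moreover have "c * exp (- mu P * (adel P / vplus P)) < mu P"
    using assms unfolding gamma3_def c_def by simp
  ultimately have "\<forall>\<^sub>F y in at_top. c * exp (- mu P * delay y) < mu P"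
    by (rule order_tendstoD(2))
  then obtain Y where Y: "Y \<ge> 1" "c * exp (- mu P * delay Y) < mu P"
    using eventually_conj[OF eventually_ge_at_top[of 1]] eventually_happens'[OF trivial_limit_at_top_linorder] by force
  define g1 s d where "g1 = c * exp (- mu P * delay Y)" and "s = sens Y" and "d = delay Y"
  have g1: "0 < g1" "g1 < mu P"
    unfolding g1_def using c Y(2) by auto
  have s: "s > 0" and d: "d > 0"
    unfolding s_def d_def using Y(1) sens_pos delay_pos by auto
  define k where "k = 2 * (g1 / Y) * s * (mu P - g1)"
  have k: "k > 0"
    unfolding k_def using g1 s Y(1) by simp
  define M where "M = max 1 ((\<bar>N\<bar> / d\<^sup>2 + g1\<^sup>2) / k + 1)"
  have "freq_delay m (ln Y / m) > N" if m: "m \<ge> M" for m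
  proof -
    have m1: "m \<ge> 1" and mk: "m > (\<bar>N\<bar> / d\<^sup>2 + g1\<^sup>2) / k"
      using m unfolding M_def by auto
    define u where "u = ln Y / m"
    have u: "0 \<le> u" "u \<le> ln Y" "exp (m * u) = Y"
      unfolding u_def using m1 Y(1) by (auto simp: divide_le_eq mult_le_cancel_left1)
    define g where "g = gamma_of P m (state u)"
    have geq: "g = g1 * exp (- u)"
      unfolding g_def gamma_of_state u(3) g1_def c_def by (simp add: exp_minus field_simps)
    have "g \<le> g1"
      unfolding geq using g1 u by simp
    moreover have "g \<ge> g1 / Y"
    proof -
      have "exp (- u) \<ge> exp (- ln Y)"
        using u by simp
      then have "exp (- u) \<ge> 1 / Y"
        using Y(1) by (simp add: exp_minus inverse_eq_divide)
      then show ?thesis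
        unfolding geq using mult_left_mono[of "1 / Y" "exp (- u)" g1] g1 by simp
    qed
    ultimately have g: "g1 / Y \<le> g" "g \<le> g1"
      by simp_all
    have g0: "g > 0"
      unfolding geq using g1 by simp
    have "(g1 / Y) * m * s \<le> g * m * s"
      using g m1 s by (intro mult_right_mono) auto
    then have "2 * ((g1 / Y) * m * s) * (mu P - g1) \<le> 2 * (g * m * s) * (mu P - g)"
      using g g1 g0 m1 s Y(1) by (intro mult_mono) auto
    moreover have "g\<^sup>2 \<le> g1\<^sup>2"
      using g g0 by (intro power_mono) auto
    ultimately have "freq_sq (mu P) g (g * m * s) \<ge> k * m - g1\<^sup>2"
      unfolding freq_sq_def k_def by (simp add: mult_ac)
    moreover have "k * m - g1\<^sup>2 > \<bar>N\<bar> / d\<^sup>2"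
      using mk k by (simp add: pos_divide_less_eq mult.commute)
    ultimately have "freq_sq (mu P) g (g * m * s) > \<bar>N\<bar> / d\<^sup>2"
      by linarith
    then have "freq_sq (mu P) g (g * m * s) * d\<^sup>2 > \<bar>N\<bar>"
      using d by (simp add: pos_divide_less_eq)
    moreover have "freq_delay m u = freq_sq (mu P) g (g * m * s) * d\<^sup>2"
      unfolding freq_delay_def g_def s_def d_def u(3) ..
    ultimately show ?thesis
      unfolding u_def by linarith
  qed
  moreover have "M \<ge> 1"
    unfolding M_def by simp
  ultimately show ?thesis
    using that Y(1) by blast
qed

lemma hopf_families_in_gamma:
  assumes "mu P > gamma3 P"
  shows "\<exists>M>0. \<forall>m\<ge>M. \<forall>j\<le>k.
         (\<exists>gam0>0. \<exists>\<omega>.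
            crosses_lr (\<lambda>gam z. charfun P m gam (steady P m gam) z) gam0 \<omega> \<and>
            \<omega> * tau P m (steady P m gam0) \<in> {(2 * real j + 1) * pi<..<(2 * real j + 2) * pi})
       \<and> (\<exists>gam0>0. \<exists>\<omega>.
            crosses_rl (\<lambda>gam z. charfun P m gam (steady P m gam) z) gam0 \<omega> \<and>
            \<omega> * tau P m (steady P m gam0) \<in> {(2 * real j + 1) * pi<..<(2 * real j + 2) * pi})"
    (is "\<exists>M>0. \<forall>m\<ge>M. \<forall>j\<le>k. ?lr m j \<and> ?rl m j")
proof -
  obtain Y M where YM: "Y \<ge> 1" "M \<ge> 1" "\<And>m. m \<ge> M \<Longrightarrow> freq_delay m (ln Y / m) > (2 * (real k + 1) * pi)\<^sup>2"
    using freq_delay_transition_layer[OF assms] by metis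
  have "?lr m j \<and> ?rl m j" if m: "m \<ge> M" and j: "j \<le> k" for m j
  proof
    have m0: "m > 0"
      using m YM(2) by simp
    have "(2 * (real j + 1) * pi)\<^sup>2 \<le> (2 * (real k + 1) * pi)\<^sup>2"
      using j by (intro power_mono mult_right_mono) auto
    then have mid: "freq_delay m (ln Y / m) > (2 * (real j + 1) * pi)\<^sup>2"
      using YM(3)[OF m] by linarith
    obtain u where "u > ln Y / m" "freq_delay m u < pi\<^sup>2"
      using freq_delay_large_state[OF m0] by metis
    then show "?lr m j"
      using mid by (intro hopf_lr_in_gamma[OF m0])
    have "ln (gamma3 P / mu P) < 0"
      using assms gamma3_pos pos by simp
    moreover have "ln Y / m \<ge> 0"
      using YM(1) m0 by simp
    ultimately have "ln (gamma3 P / mu P) < ln Y / m"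
      by linarith
    then show "?rl m j"
      using mid freq_delay_small_state[OF m0 order_refl] by (intro hopf_rl_in_gamma[OF m0])
  qed
  then show ?thesis
    using YM(2) by (intro exI[of _ M]) auto
qed

section \<open>Hopf bifurcations in the Hill exponent\<close>

definition ratio_of_delay :: "real \<Rightarrow> real" where
  "ratio_of_delay \<tau> = (vminus P * \<tau> - adel P) / (adel P - vplus P * \<tau>)"

definition delays :: "real set" where
  "delays = {adel P / vminus P<..<adel P / vplus P}"

lemma delays_iff: "\<tau> \<in> delays \<longleftrightarrow> vminus P * \<tau> - adel P > 0 \<and> adel P - vplus P * \<tau> > 0"
  unfolding delays_def using pos vminus_pos by (auto simp: field_simps)

lemma delays_pos: "\<tau> \<in> delays \<Longrightarrow> \<tau> > 0"
  unfolding delays_def using pos vminus_pos by (auto intro: less_trans[rotated])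

lemma ratio_of_delay_pos: "\<tau> \<in> delays \<Longrightarrow> ratio_of_delay \<tau> > 0"
  unfolding delays_iff ratio_of_delay_def by simp

lemma delay_ratio_of_delay:
  assumes "\<tau> \<in> delays"
  shows "delay (ratio_of_delay \<tau>) = \<tau>"
proof -
  define n d where "n = vminus P * \<tau> - adel P" and "d = adel P - vplus P * \<tau>"
  have nd: "n > 0" "d > 0"
    using assms unfolding delays_iff n_def d_def by auto
  have "1 + n / d = (vminus P - vplus P) * \<tau> / d"
    using nd unfolding n_def d_def by (simp add: field_simps)
  moreover have "vminus P + vplus P * (n / d) = (vminus P - vplus P) * adel P / d"
    using nd unfolding n_def d_def by (simp add: field_simps)
  ultimately show ?thesis
    unfolding delay_def ratio_of_delay_def n_def[symmetric] d_def[symmetric]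
    using nd decr pos by simp
qed

lemma ratio_of_delay_delay:
  assumes "y > 0"
  shows "ratio_of_delay (delay y) = y"
proof -
  define d where "d = vminus P + vplus P * y"
  have d: "d > 0"
    unfolding d_def using denom_pos assms by simp
  have "vminus P * delay y - adel P = adel P * (vminus P - vplus P) * y / d"
    "adel P - vplus P * delay y = adel P * (vminus P - vplus P) / d"
    unfolding delay_def d_def[symmetric] using d by (simp_all add: field_simps) (simp_all add: d_def algebra_simps)
  then show ?thesis
    unfolding ratio_of_delay_def using d pos decr by simp
qed

lemma ratio_of_delay_mono:
  assumes "\<tau> \<in> delays" "\<tau>' \<in> delays" "\<tau> < \<tau>'"
  shows "ratio_of_delay \<tau> < ratio_of_delay \<tau>'"
proof (rule ccontr)
  assume "\<not> ratio_of_delay \<tau> < ratio_of_delay \<tau>'"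
  then consider "ratio_of_delay \<tau>' < ratio_of_delay \<tau>" | "ratio_of_delay \<tau>' = ratio_of_delay \<tau>"
    by linarith
  then show False
  proof cases
    case 1
    then show False
      using delay_mono[OF _ 1] ratio_of_delay_pos[OF assms(2)] assms(3)
      by (simp add: delay_ratio_of_delay assms)
  next
    case 2
    then show False
      using assms by (metis delay_ratio_of_delay less_irrefl)
  qed
qed

lemma delay_in_delays: "y > 0 \<Longrightarrow> delay y \<in> delays"
  unfolding delays_def using delay_bounds by simp

text \<open>In the exceptional case \<open>\<gamma> = \<beta> g e\<^bsup>-\<mu> \<tau>(\<theta>)\<^esup> / \<theta>\<close> the steady state is
  \<open>\<theta>\<close> for every \<open>m\<close>, so that it cannot serve as the curve parameter.\<close>

lemma hopf_in_exponent_fixed_state: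
  assumes gam: "gam = beta P * gpm P * exp (- mu P * delay 1) / thetav P" "gam < mu P"
  shows "\<exists>m0>0. \<exists>\<omega>.
            crosses_lr (\<lambda>m z. charfun P m gam (steady P m gam) z) m0 \<omega> \<and>
            \<omega> * tau P m0 (steady P m0 gam) \<in> {(2 * real k + 1) * pi<..<(2 * real k + 2) * pi}"
proof -
  have th: "thetav P > 0"
    by (rule pos)
  have ratio: "ratio m (thetav P) = 1" for m
    unfolding ratio_def using pos by simp
  have g: "gamma_of P m (thetav P) = gam" for m
    unfolding gamma_of_eq[OF th] ratio gam(1) ..
  have g0: "gam > 0"
    using gamma_of_pos[OF th] g by metis
  have st: "steady P m gam = thetav P" if "m > 0" for m
    using steady_gamma_of[OF that th] unfolding g .
  define s d where "s = sens 1" and "d = delay 1"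
  have s: "s > 0" and d: "d > 0"
    unfolding s_def d_def using sens_pos delay_pos by auto
  define N where "N = (2 * (real k + 1) * pi)\<^sup>2"
  define c where "c = 2 * gam * s * (mu P - gam)"
  have c: "c > 0"
    unfolding c_def using g0 s gam(2) by simp
  define m1 m2 where "m1 = gam\<^sup>2 / c" and "m2 = (N / d\<^sup>2 + gam\<^sup>2) / c + 1"
  have fr: "freq_sq (mu P) gam (gam * m * s) = c * m - gam\<^sup>2" for m
    unfolding freq_sq_def c_def by simp
  have m12: "0 < m1" "m1 < m2"
    unfolding m1_def m2_def N_def using g0 c d by (auto simp: add_divide_distrib add_nonneg_pos)
  have l: "freq_sq (mu P) gam (gam * m1 * s) * d\<^sup>2 < pi\<^sup>2"
    unfolding fr m1_def using c by simp
  have "N / d\<^sup>2 < c * m2 - gam\<^sup>2"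
    unfolding m2_def using c by (simp add: field_simps)
  then have r: "freq_sq (mu P) gam (gam * m2 * s) * d\<^sup>2 > N"
    unfolding fr using d by (simp add: pos_divide_less_eq)
  have B: "gam * m * s > 0" if "m \<in> {m1..m2}" for m
    using that m12 g0 s by simp
  show ?thesis
  proof (rule analytic_crossing[OF pos(2) m12(2) real_analytic_on_const[of gam] real_analytic_on_const[of d],
        of "\<lambda>m. gam * m * s" k])
    show "(\<lambda>m. gam * m * s) real_analytic_on {m1..m2}"
      by (intro real_analytic_intros)
  next
    fix t0 \<omega>
    assume t0: "m1 < t0" "t0 < m2" "crosses_lr (\<lambda>t. char_red (mu P) gam d (gam * t * s)) t0 \<omega>"
      "\<omega> * d \<in> {(2 * real k + 1) * pi<..<(2 * real k + 2) * pi}"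
    have "crosses_lr (\<lambda>m z. charfun P m gam (steady P m gam) z) t0 \<omega>"
    proof (rule crosses_lr_reparam[OF t0(3,1,2), where q = "\<lambda>t. t" and r = "\<lambda>t. t"])
      show "charfun P t gam (steady P t gam) z = char_red (mu P) gam d (gam * t * s) z"
        if "t \<in> {m1..m2}" for t z
        using charfun_eq[OF th, of t] that m12 st[of t] unfolding g ratio s_def d_def by simp
    qed auto
    moreover have "tau P t0 (steady P t0 gam) = d"
      using st[of t0] t0(1) m12(1) tau_eq[OF th, of t0] unfolding ratio d_def by simp
    ultimately show ?thesis
      using t0 m12(1) by (intro exI[of _ t0]) auto
  qed (use g0 d B l r in \<open>auto simp: N_def\<close>)
qed

lemma hopf_in_exponent_moving_state:
  assumes gam: "gam = beta P * gpm P * exp (- mu P * T) / thetav P" "gam < mu P"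
    and T: "T \<in> delays" "T \<noteq> delay 1"
  shows "\<exists>m0>0. \<exists>\<omega>.
            crosses_lr (\<lambda>m z. charfun P m gam (steady P m gam) z) m0 \<omega> \<and>
            \<omega> * tau P m0 (steady P m0 gam) \<in> {(2 * real k + 1) * pi<..<(2 * real k + 2) * pi}"
proof -
  have g0: "gam > 0"
    unfolding gam using pos by simp
  define d where "d t = delay 1 + t * (T - delay 1)" for t
  define u0 where "u0 = mu P * (T - delay 1)"
  have u0: "u0 \<noteq> 0"
    unfolding u0_def using T pos by simp
  have dI: "d t \<in> delays" if "t \<in> {0..1}" for t
  proof -
    have "convex delays"
      unfolding delays_def by simp
    moreover have "d t = (1 - t) *\<^sub>R delay 1 + t *\<^sub>R T"
      unfolding d_def by (simp add: algebra_simps)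
    ultimately show ?thesis
      using convexD_alt[of delays "delay 1" T t] T(1) delay_in_delays[of 1] that by simp
  qed
  define Y where "Y t = ratio_of_delay (d t)" for t
  have Y0: "Y t > 0" if "t \<in> {0..1}" for t
    unfolding Y_def by (rule ratio_of_delay_pos[OF dI[OF that]])
  have dY: "delay (Y t) = d t" if "t \<in> {0..1}" for t
    unfolding Y_def by (rule delay_ratio_of_delay[OF dI[OF that]])
  define f where "f t = ln (Y t) / u0" for t
  have f_mono: "f s < f t" if "s \<in> {0..1}" "t \<in> {0..1}" "s < t" for s t
  proof (cases "T > delay 1")
    case True
    then have "d s < d t"
      unfolding d_def using that by simp
    then have "ln (Y s) < ln (Y t)"
      using Y0 that ratio_of_delay_mono[OF dI dI] unfolding Y_def by simp
    then show ?thesis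
      unfolding f_def u0_def using True pos by (intro divide_strict_right_mono) auto
  next
    case False
    then have F: "T < delay 1"
      using T(2) by simp
    then have "d t < d s"
      unfolding d_def using that by simp
    then have "ln (Y t) < ln (Y s)"
      using Y0 that ratio_of_delay_mono[OF dI dI] unfolding Y_def by simp
    moreover have "u0 < 0"
      unfolding u0_def using F pos by (simp add: mult_pos_neg)
    ultimately show ?thesis
      unfolding f_def by (intro divide_strict_right_mono_neg)
  qed
  have "Y 0 = 1"
    unfolding Y_def d_def by (simp add: ratio_of_delay_delay)
  then have f_0: "f 0 = 0"
    unfolding f_def by simp
  have f_pos: "f t > 0" if "t \<in> {0<..1}" for t
    using f_mono[of 0 t] that unfolding f_0 by simp
  have dan: "d real_analytic_on S" for S
    unfolding d_def by (intro real_analytic_intros)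
  have Yan: "Y real_analytic_on {0..1}"
    unfolding Y_def ratio_of_delay_def
    by (intro real_analytic_intros dan) (use dI delays_iff in force)
  then have fan: "f real_analytic_on {0..1}"
    unfolding f_def using Y0 u0 by (intro real_analytic_intros) auto
  define M where "M t = f t / (1 - t)" for t
  define B where "B t = gam * M t * sens (Y t)" for t
  have M_mono: "M s < M t" if "s \<in> {0..<1}" "t \<in> {0..<1}" "s < t" for s t
  proof -
    have "f s / (1 - s) \<le> f s / (1 - t)"
      using that f_pos[of s] f_0 by (intro divide_left_mono) (auto simp: order_le_less)
    also have "\<dots> < f t / (1 - t)"
      using that f_mono[of s t] by (intro divide_strict_right_mono) auto
    finally show ?thesis
      unfolding M_def .
  qed
  have M_pos: "M t > 0" if "t \<in> {0<..<1}" for t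
    unfolding M_def using that f_pos[of t] by simp
  have x: "ratio (M t) (state (u0 * (1 - t))) = Y t" "gamma_of P (M t) (state (u0 * (1 - t))) = gam"
    if t: "t \<in> {0<..<1}" for t
  proof -
    have "M t * (u0 * (1 - t)) = ln (Y t)"
      unfolding M_def f_def using u0 t by simp
    then show *: "ratio (M t) (state (u0 * (1 - t))) = Y t"
      unfolding ratio_state using Y0[of t] t by simp
    have "gamma_of P (M t) (state (u0 * (1 - t))) = beta P * gpm P * exp (- mu P * d t) / state (u0 * (1 - t))"
      unfolding gamma_of_eq[OF state_pos] * using dY[of t] t by simp
    also have "\<dots> = beta P * gpm P * (exp (- mu P * d t) * exp (- (u0 * (1 - t)))) / thetav P"
      unfolding exp_minus[of "u0 * (1 - t)"] by (simp add: divide_inverse)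
    also have "exp (- mu P * d t) * exp (- (u0 * (1 - t))) = exp (- mu P * T)"
      unfolding exp_add[symmetric] d_def u0_def by (simp add: algebra_simps)
    finally show "gamma_of P (M t) (state (u0 * (1 - t))) = gam"
      unfolding gam(1) .
  qed
  have st: "steady P (M t) gam = state (u0 * (1 - t))" if "t \<in> {0<..<1}" for t
    using steady_gamma_of[OF M_pos[OF that] state_pos, of "u0 * (1 - t)"] unfolding x(2)[OF that] .
  have char: "charfun P (M t) gam (steady P (M t) gam) = char_red (mu P) gam (d t) (B t)"
    if "t \<in> {0<..<1}" for t
    using charfun_eq[OF state_pos, of "M t" "u0 * (1 - t)"] dY[of t] that
    unfolding st[OF that] x[OF that] B_def by simp
  have tau: "tau P (M t) (steady P (M t) gam) = d t" if "t \<in> {0<..<1}" for t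
    unfolding st[OF that] tau_eq[OF state_pos] x(1)[OF that] using dY[of t] that by simp
  have B_pos: "B t > 0" if "t \<in> {0<..<1}" for t
    unfolding B_def using g0 M_pos[OF that] sens_pos[OF Y0[of t]] that by simp
  obtain a where a: "0 < a" "a < 1 / 2" "freq_sq (mu P) gam (B a) * (d a)\<^sup>2 < pi\<^sup>2"
  proof -
    have "M real_analytic_on {0..1/2}"
      unfolding M_def by (intro real_analytic_intros real_analytic_on_subset[OF fan]) auto
    then have "continuous_on {0..1/2} M"
      by (rule real_analytic_on_imp_continuous_on)
    moreover have "M 0 = 0"
      unfolding M_def f_0 by simp
    moreover define e where "e = gam / (2 * (mu P - gam))"
    moreover have e: "e > 0"
      unfolding e_def using g0 gam(2) by simp
    ultimately obtain \<delta> where \<delta>: "\<delta> > 0" "\<And>t. t \<in> {0..1/2} \<Longrightarrow> \<bar>t\<bar> < \<delta> \<Longrightarrow> \<bar>M t\<bar> < e"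
      unfolding continuous_on_iff dist_real_def by (metis atLeastAtMost_iff diff_zero order_refl zero_le_divide_1_iff zero_le_numeral)
    define a where "a = min (\<delta> / 2) (1 / 4)"
    have a: "0 < a" "a < 1 / 2" "a < \<delta>"
      unfolding a_def using \<delta>(1) by auto
    then have "M a < e"
      using \<delta>(2)[of a] by simp
    have "B a \<le> gam * M a * 1"
      unfolding B_def using g0 M_pos[of a] a sens_less_1[OF Y0[of a]] by (intro mult_left_mono) auto
    also have "\<dots> < gam * e"
      using \<open>M a < e\<close> g0 by simp
    finally have "2 * B a * (mu P - gam) < 2 * (gam * e) * (mu P - gam)"
      using gam(2) by simp
    also have "\<dots> = gam\<^sup>2"
      unfolding e_def using gam(2) by (simp add: power2_eq_square divide_simps)
    finally have "freq_sq (mu P) gam (B a) * (d a)\<^sup>2 \<le> 0"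
      unfolding freq_sq_def by (intro mult_nonpos_nonneg) auto
    then have "freq_sq (mu P) gam (B a) * (d a)\<^sup>2 < pi\<^sup>2"
      using pi_gt_zero by (smt (verit) zero_less_power)
    then show ?thesis
      using that a by blast
  qed
  define N where "N = (2 * (real k + 1) * pi)\<^sup>2"
  obtain b where b: "1 / 2 < b" "b < 1" "freq_sq (mu P) gam (B b) * (d b)\<^sup>2 > N"
  proof -
    define h where "h t = gam * f t * sens (Y t)" for t
    have "h real_analytic_on {0..1}"
      unfolding h_def by (intro real_analytic_intros fan Yan Y0)
    then have "continuous_on {0..1} h"
      by (rule real_analytic_on_imp_continuous_on)
    then have "(h \<longlongrightarrow> h 1) (at 1 within {0..1})"
      by (simp add: continuous_on_def)
    then have "(h \<longlongrightarrow> h 1) (at_left 1)"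
      by (simp add: at_within_Icc_at_left)
    moreover have "h 1 > 0"
      unfolding h_def using g0 f_pos[of 1] sens_pos[OF Y0[of 1]] by simp
    moreover have "filterlim (\<lambda>t::real. 1 / (1 - t)) at_top (at_left 1)"
      by real_asymp
    ultimately have "filterlim (\<lambda>t. h t * (1 / (1 - t))) at_top (at_left 1)"
      by (rule filterlim_tendsto_pos_mult_at_top)
    moreover define d0 where "d0 = adel P / vminus P"
    moreover define B0 where "B0 = (N / d0\<^sup>2 + gam\<^sup>2) / (2 * (mu P - gam))"
    ultimately have "\<forall>\<^sub>F t in at_left 1. h t * (1 / (1 - t)) > B0"
      by (simp add: filterlim_at_top_dense)
    moreover have "\<forall>\<^sub>F t::real in at_left 1. t \<in> {1/2<..<1}"
      by (rule eventually_at_leftI[of "1/2"]) auto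
    ultimately obtain b where b: "h b * (1 / (1 - b)) > B0" "b \<in> {1/2<..<1}"
      using eventually_happens'[OF trivial_limit_at_left_real eventually_conj] by blast
    have d0: "d0 > 0" "d0 < d b"
      using dI[of b] b(2) pos vminus_pos unfolding d0_def delays_def by auto
    have "B b > B0"
      using b(1) unfolding B_def M_def h_def by (simp add: mult_ac)
    then have "freq_sq (mu P) gam (B b) > N / d0\<^sup>2"
      unfolding B0_def freq_sq_def using gam(2) by (simp add: pos_divide_less_eq algebra_simps)
    then have *: "N < freq_sq (mu P) gam (B b) * d0\<^sup>2"
      using d0 by (simp add: pos_divide_less_eq)
    have "freq_sq (mu P) gam (B b) \<ge> 0"
      using \<open>freq_sq (mu P) gam (B b) > N / d0\<^sup>2\<close> unfolding N_def
      by (smt (verit) divide_nonneg_nonneg zero_le_power2)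
    then have "freq_sq (mu P) gam (B b) * d0\<^sup>2 \<le> freq_sq (mu P) gam (B b) * (d b)\<^sup>2"
      using d0 by (intro mult_left_mono power_mono) auto
    then show ?thesis
      using that[of b] * b(2) by auto
  qed
  have ab: "a < b"
    using a b by linarith
  have I: "t \<in> {0<..<1}" if "t \<in> {a..b}" for t
    using that a(1) b(2) by auto
  have Man: "M real_analytic_on {a..b}"
    unfolding M_def using a b
    by (intro real_analytic_intros real_analytic_on_subset[OF fan]) auto
  show ?thesis
  proof (rule analytic_crossing[OF pos(2) ab real_analytic_on_const[of gam] dan, of B k])
    show "B real_analytic_on {a..b}"
      unfolding B_def using a b Y0
      by (intro real_analytic_intros Man real_analytic_on_subset[OF Yan]) auto
    show "d t > 0" "B t > 0" if "t \<in> {a..b}" for t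
      using delays_pos[OF dI[of t]] B_pos[OF I[OF that]] I[OF that] by auto
  next
    fix t0 \<omega>
    assume t0: "a < t0" "t0 < b" "crosses_lr (\<lambda>t. char_red (mu P) gam (d t) (B t)) t0 \<omega>"
      "\<omega> * d t0 \<in> {(2 * real k + 1) * pi<..<(2 * real k + 2) * pi}"
    have t01: "t0 \<in> {0<..<1}"
      using t0 by (intro I) auto
    have "crosses_lr (\<lambda>m z. charfun P m gam (steady P m gam) z) (M t0) \<omega>"
    proof (rule crosses_lr_reparam[OF t0(3,1,2), where r = "\<lambda>m. 1 - ln (steady P m gam / thetav P) / u0"])
      show "continuous_on {a..b} M"
        using Man by (rule real_analytic_on_imp_continuous_on)
      show "1 - ln (steady P (M t) gam / thetav P) / u0 = t" if "t \<in> {a..b}" for t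
        unfolding st[OF I[OF that]] using u0 pos by simp
      show "charfun P (M t) gam (steady P (M t) gam) z = char_red (mu P) gam (d t) (B t) z" if "t \<in> {a..b}" for t z
        unfolding char[OF I[OF that]] ..
      show "M s < M t" if "s \<in> {a..b}" "t \<in> {a..b}" "s < t" for s t
        using M_mono[of s t] I[OF that(1)] I[OF that(2)] that(3) by simp
    qed
    then show ?thesis
      using t0(4) M_pos[OF t01] unfolding tau[OF t01, symmetric] by blast
  qed (use g0 a b in \<open>auto simp: N_def\<close>)
qed

lemma hopf_in_exponent:
  assumes "gamma3 P < gam" "gam < min (gamma4 P) (mu P)"
  shows "\<exists>m0>0. \<exists>\<omega>.
            crosses_lr (\<lambda>m z. charfun P m gam (steady P m gam) z) m0 \<omega> \<and>
            \<omega> * tau P m0 (steady P m0 gam) \<in> {(2 * real k + 1) * pi<..<(2 * real k + 2) * pi}"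
proof -
  define c where "c = beta P * gpm P / thetav P"
  have c: "c > 0"
    unfolding c_def using pos by simp
  have g0: "gam > 0"
    using assms gamma3_pos by linarith
  define T where "T = ln (c / gam) / mu P"
  have "exp (- mu P * T) = gam / c"
    unfolding T_def using pos c g0 by (simp add: exp_minus)
  then have gam: "gam = c * exp (- mu P * T)"
    using c by simp
  have "gamma3 P = c * exp (- mu P * (adel P / vplus P))" "gamma4 P = c * exp (- mu P * (adel P / vminus P))"
    unfolding gamma3_def gamma4_def c_def by simp_all
  then have "c * exp (- mu P * (adel P / vplus P)) < c * exp (- mu P * T)"
       "c * exp (- mu P * T) < c * exp (- mu P * (adel P / vminus P))"
    unfolding gam[symmetric] using assms by simp_all
  then have "mu P * T < mu P * (adel P / vplus P)" "mu P * (adel P / vminus P) < mu P * T"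
    using c by (simp_all del: times_divide_eq_right)
  then have T: "T \<in> delays"
    unfolding delays_def using pos by (simp del: times_divide_eq_right)
  have gam': "gam = beta P * gpm P * exp (- mu P * T) / thetav P"
    using gam unfolding c_def by simp
  show ?thesis
  proof (cases "T = delay 1")
    case True
    then show ?thesis
      using hopf_in_exponent_fixed_state[of gam k] gam' assms(2) by simp
  next
    case False
    then show ?thesis
      using hopf_in_exponent_moving_state[OF gam' _ T] assms(2) by simp
  qed
qed

end

theorem theorem5p6:
  fixes P :: dde_params
  assumes pos: "beta P > 0" "mu P > 0" "adel P > 0" "gpm P > 0"
      "vplus P > 0" "thetav P > 0"
    and decr: "vminus P > vplus P"
  shows
    \<comment> \<open>(1)\<close>
    "(\<forall>m gam x. m > 0 \<and> gam > 0 \<and> is_steady P m gam x \<and>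
        \<bar>x * deriv (vfun P m) x / vfun P m x\<bar> < 1 / (mu P * tau P m x)
        \<longrightarrow> asym_stable P m gam x)
   \<and> \<comment> \<open>(2)\<close>
    (\<forall>m gam x. m > 0 \<and> gam > 0 \<and> is_steady P m gam x \<and>
        (m \<le> 1 / (mu P * tau P m x) \<or>
         (m > 1 / (mu P * tau P m x) \<and>
          vminus P / vplus P < (1 + 2 / (m * mu P * tau P m x - 1))^2))
        \<longrightarrow> asym_stable P m gam x)
   \<and> \<comment> \<open>(3)\<close>
    (\<forall>m>0.
       (\<exists>\<delta>>0. \<exists>K. \<forall>x. 0 < x \<and> (x < \<delta> \<or> x > K) \<longrightarrow> asym_stable P m (gamma_of P m x) x)
     \<and> (\<exists>G1 G2. G2 > 0 \<and> (\<forall>gam x. (gam > G1 \<or> (0 < gam \<and> gam < G2)) \<and> is_steady P m gam x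
            \<longrightarrow> asym_stable P m gam x)))
   \<and> \<comment> \<open>(4)\<close>
    (\<forall>m gam x. m > 0 \<and> gam > mu P \<and> is_steady P m gam x \<longrightarrow> asym_stable P m gam x)
   \<and> \<comment> \<open>(5)\<close>
    (\<forall>x. 0 < x \<and> x \<noteq> thetav P \<longrightarrow>
        (\<exists>M>0. \<forall>m\<ge>M. asym_stable P m (gamma_of P m x) x))
   \<and> (\<forall>gam. (0 < gam \<and> gam < gamma3 P) \<or> gam > gamma4 P \<longrightarrow>
        (\<exists>M>0. \<forall>m\<ge>M. \<forall>x. is_steady P m gam x \<longrightarrow> asym_stable P m gam x))
   \<and> \<comment> \<open>(6a)\<close>
    (mu P > gamma3 P \<longrightarrow>
      (\<forall>k::nat. k > 0 \<longrightarrow> (\<exists>M>0. \<forall>m\<ge>M. \<forall>j\<le>k.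
         (\<exists>gam0>0. \<exists>\<omega>.
            crosses_lr (\<lambda>gam z. charfun P m gam (steady P m gam) z) gam0 \<omega> \<and>
            \<omega> * tau P m (steady P m gam0) \<in> {(2 * real j + 1) * pi<..<(2 * real j + 2) * pi})
       \<and> (\<exists>gam0>0. \<exists>\<omega>.
            crosses_rl (\<lambda>gam z. charfun P m gam (steady P m gam) z) gam0 \<omega> \<and>
            \<omega> * tau P m (steady P m gam0) \<in> {(2 * real j + 1) * pi<..<(2 * real j + 2) * pi}))))
   \<and> \<comment> \<open>(6b)\<close>
    (mu P > gamma3 P \<longrightarrow>
      (\<forall>gam. gamma3 P < gam \<and> gam < min (gamma4 P) (mu P) \<longrightarrow>
        (\<forall>k::nat. \<exists>m0>0. \<exists>\<omega>.
            crosses_lr (\<lambda>m z. charfun P m gam (steady P m gam) z) m0 \<omega> \<and>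
            \<omega> * tau P m0 (steady P m0 gam) \<in> {(2 * real k + 1) * pi<..<(2 * real k + 2) * pi})))"
proof -
  interpret dde P
    using pos decr by unfold_locales
  have "\<exists>\<delta>>0. \<exists>K. \<forall>x. 0 < x \<and> (x < \<delta> \<or> x > K) \<longrightarrow> asym_stable P m (gamma_of P m x) x" if "m > 0" for m
    by (rule stable_extreme_states[OF that]) blast
  then show ?thesis
    by (intro conjI allI impI stable_extreme_gamma stable_large_exponent_fixed_state
          stable_large_exponent_fixed_gamma hopf_families_in_gamma hopf_in_exponent)
       (blast intro: stable_of_elasticity stable_of_hill_exponent stable_of_large_gamma)+
qed

end
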